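(* Let $\alpha>0$ and $N_k=\lambda^k$, where $\lambda>1$. Given any $T>0$, there exists a non-positive solution $Y=(Y_k)_{k\ge1}$ of $$Y_k'=N_k^\alpha Y_{k+1}^2-N_{k-1}^\alpha Y_{k-1}Y_k,\qquad k\ge1,\qquad Y_0=0,$$ with $Y_k\in C^1([0,\infty))$ for every $k\ge1$, such that $$Y(t)=0\ \text{ for } t\ge T,\qquad \|Y(t)\|_{\ell^2}=1\ \text{ for } 0\le t<T.$$ Moreover, $$Y\in\bigcap_{s<\alpha}C([0,T);H^s)\cap\bigcap_{s<0}C([0,\infty);H^s),$$ and for every $0<r<\alpha$, there are constants $c_r>0$ and $0<\delta_r\le T$ such that $$\|Y(t)\|_{H^r}\ge c_r(T-t)^{-r/\alpha},\qquad T-\delta_r<t<T.$$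
   Context: For a real sequence $Y=(Y_k)_{k\ge1}$ and $s\in\mathbb R$, $\|Y\|_{H^s}^2:=\sum_{k\ge1}N_k^{2s}Y_k^2$, $H^s$ is the space of sequences with finite norm, and $H^0=\ell^2$. Convention $N_0=1$ (immaterial, since $Y_0=0$). Solutions are understood componentwise. Non-positive means $Y_k(t)\le0$ for all $k$ and $t$. *)

theory Defs
  imports "HOL-Analysis.Analysis"
begin

text \<open>
  A sequence \<open>(y_k)_{k \<ge> 1}\<close> is represented by a function on \<^typ>\<open>nat\<close>; the norms, spaces and the
  equations below range over \<open>k \<ge> 1\<close>, the value at index \<open>0\<close> being reserved for the boundary
  condition \<open>Y_0 = 0\<close>. A time-dependent sequence is a function \<^typ>\<open>real \<Rightarrow> nat \<Rightarrow> real\<close>, of which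
  only the values at times \<open>t \<ge> 0\<close> are relevant.
\<close>

definition shell :: "real \<Rightarrow> nat \<Rightarrow> real" where
  "shell lam k = lam ^ k"

definition Hs_space :: "real \<Rightarrow> real \<Rightarrow> (nat \<Rightarrow> real) set" where
  "Hs_space lam s = {y. (\<lambda>k. shell lam k powr (2 * s) * (y k)\<^sup>2) summable_on {1..}}"

text \<open>Meaningful for \<open>y\<close> in \<open>H^s\<close> only: a divergent \<^const>\<open>infsum\<close> has the value \<open>0\<close>.\<close>

definition Hs_norm :: "real \<Rightarrow> real \<Rightarrow> (nat \<Rightarrow> real) \<Rightarrow> real" where
  "Hs_norm lam s y = sqrt (\<Sum>\<^sub>\<infinity>k\<in>{1..}. shell lam k powr (2 * s) * (y k)\<^sup>2)"

text \<open>The space \<open>C(I; H^s)\<close>, with continuity in the norm topology of \<open>H^s\<close>.\<close>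

definition continuous_Hs :: "real \<Rightarrow> real \<Rightarrow> real set \<Rightarrow> (real \<Rightarrow> nat \<Rightarrow> real) \<Rightarrow> bool" where
  "continuous_Hs lam s I Y \<longleftrightarrow>
     (\<forall>t\<in>I. Y t \<in> Hs_space lam s) \<and>
     (\<forall>t\<in>I. ((\<lambda>u. Hs_norm lam s (\<lambda>k. Y u k - Y t k)) \<longlongrightarrow> 0) (at t within I))"

text \<open>
  Continuous differentiability relative to \<open>I\<close>, hence with one-sided derivatives at end points in
  \<open>I\<close>; the library's \<^const>\<open>C1_differentiable_on\<close> demands two-sided derivatives there.
\<close>

definition C1_within :: "real set \<Rightarrow> (real \<Rightarrow> real) \<Rightarrow> bool" where
  "C1_within I f \<longleftrightarrow>
     (\<exists>f'. (\<forall>t\<in>I. (f has_real_derivative f' t) (at t within I)) \<and> continuous_on I f')"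

definition dyadic_solution :: "real \<Rightarrow> real \<Rightarrow> (real \<Rightarrow> nat \<Rightarrow> real) \<Rightarrow> bool" where
  "dyadic_solution \<alpha> lam Y \<longleftrightarrow>
     (\<forall>t\<ge>0. Y t 0 = 0) \<and>
     (\<forall>k\<ge>1. \<forall>t\<ge>0.
        ((\<lambda>u. Y u k) has_real_derivative
           (shell lam k powr \<alpha> * (Y t (k + 1))\<^sup>2 - shell lam (k - 1) powr \<alpha> * Y t (k - 1) * Y t k))
        (at t within {0..}))"

end

theory Submission
  imports Defs "HOL-Complex_Analysis.Great_Picard" "HOL-Probability.Discrete_Topology"
begin

text \<open>
  With \<open>\<mu> = lam powr \<alpha>\<close> and \<open>Y_k(t) = - Z_k(T - t)\<close> the system is invariant, so one needs a
  non-negative solution \<open>Z\<close> that starts from \<open>0\<close> and has energy \<open>1\<close> at every positive time: energy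
  enters from infinitely high modes. It is a limit of the truncations to the modes \<open>1, \<dots>, n\<close>
  started with all energy in mode \<open>n\<close>. That no energy is lost in the limit follows from a smoothing
  estimate uniform in \<open>n\<close>: at times \<open>t \<ge> \<tau> > 0\<close> the sums \<open>\<Sum> (p^k z_k)^2\<close> are bounded for every
  \<open>p < \<mu>\<close>, that is, in \<open>H^s\<close> for every \<open>s < \<alpha>\<close>. The blow-up rate holds because the modes up to \<open>m\<close>
  receive energy at a rate of at most \<open>2 \<mu>^m\<close>, so that at time \<open>t\<close> half of the energy is still in
  modes with \<open>\<mu>^k\<close> of order \<open>1/t\<close> or larger.
\<close>

section \<open>Global solutions for bounded Lipschitz fields\<close>

text \<open>The sign of \<open>Z\<close> fixes the direction of transfer: in a non-negative solution
  energy passes only from mode k + 1 to mode k, at rate 2 \<mu>^k z_k z_{k+1}^2. The obstacle is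
  that the data of the truncations tend to 0 in every component, and 0 is itself a solution:
  componentwise convergence alone yields energy at most 1 and does not exclude the limit 0. What is
  missing is tightness, a bound uniform in n on some weighted energy with p > 1. Such energies
  decrease in time, but start from p^(2n). The way in is through p < 1: that weighted energy is at
  most 1 and increases, and its derivative is a weighted sum of the transfer rates, so these are
  bounded on average over time. Fed into a linear functional of the modes, the averaged bound
  controls an energy with larger weights; monotonicity turns the average into a bound at a given
  time, and the step is repeated.\<close>

lemma picard_global:
  fixes F :: "'a::banach \<Rightarrow> 'a"
  assumes L: "L > 0" and lip: "\<And>x y. norm (F x - F y) \<le> L * norm (x - y)"
    and bdd: "\<And>x. norm (F x) \<le> B"
  obtains x where "x 0 = x0"
    and "\<And>t. t \<ge> 0 \<Longrightarrow> (x has_vector_derivative F (x t)) (at t within {0..})"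
proof -
  have B0: "B \<ge> 0" using bdd[of 0] norm_ge_zero order_trans by blast
  have contF: "continuous_on UNIV F"
  proof (rule continuous_on_iff[THEN iffD2], intro ballI allI impI)
    fix x and e :: real assume e: "e > 0"
    show "\<exists>d>0. \<forall>x'\<in>UNIV. dist x' x < d \<longrightarrow> dist (F x') (F x) < e"
    proof (intro exI[of _ "e / L"] conjI ballI impI)
      fix y assume "dist y x < e / L"
      then have "L * norm (y - x) < e" using L by (simp add: dist_norm field_simps)
      then show "dist (F y) (F x) < e" using lip[of y x] by (simp add: dist_norm)
    qed (use e L in auto)
  qed
  \<comment> \<open>The unknown is rescaled as x t = exp (2 * L * t) g t. In the sup norm of g, an
    exponentially weighted norm of x, the integral operator contracts by 1/2 on the whole half-line
    at once, so no local solutions have to be glued.\<close>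
  define h where "h g s = F (exp (2 * L * s) *\<^sub>R apply_bcontfun g s)" for g and s :: real
  define J where "J g t = exp (- 2 * L * t) *\<^sub>R (x0 + integral {0..t} (h g))" for g t
  have conth: "continuous_on S (h g)" for g S
    unfolding h_def
    by (rule continuous_on_compose2[OF contF]) (auto intro!: continuous_intros)
  have inth: "h g integrable_on {a..b}" for g a b
    by (rule integrable_continuous_real) (rule conth)
  have derh: "((\<lambda>u. integral {0..u} (h g)) has_vector_derivative h g t) (at t within {0..})"
    if "t \<ge> 0" for g t
  proof -
    have "((\<lambda>u. integral {0..u} (h g)) has_vector_derivative h g t) (at t within {0..t+1})"
      by (rule integral_has_vector_derivative) (use that conth in auto)
    moreover have "at t within {0..} = at t within {0..t+1}"
      by (rule at_within_nhd[of _ "{..<t+1}"]) (use that in auto)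
    ultimately show ?thesis by simp
  qed
  have contJ: "continuous_on {0..} (J g)" for g
    unfolding J_def
    by (intro continuous_intros continuous_on_vector_derivative[of _ _ "h g"] derh) auto
  \<comment> \<open>The integral grows at most linearly because F is bounded, and the exponential
    factor beats it. The function space lives over all reals, so negative times are frozen at
    0.\<close>
  have JB: "(\<lambda>t. J g (max 0 t)) \<in> bcontfun" for g
  proof (rule bcontfun_normI)
    show "continuous_on UNIV (\<lambda>t. J g (max 0 t))"
      by (rule continuous_on_compose2[OF contJ]) (auto intro!: continuous_intros)
    fix t :: real
    define u where "u = max 0 t"
    have u: "u \<ge> 0" by (simp add: u_def)
    have "norm (integral {0..u} (h g)) \<le> integral {0..u} (\<lambda>_. B)"
      by (rule integral_norm_bound_integral[OF inth]) (auto simp: h_def bdd)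
    then have "norm (J g u) \<le> exp (- 2 * L * u) * (norm x0 + B * u)"
      unfolding J_def using u norm_triangle_ineq[of x0 "integral {0..u} (h g)"]
      by (auto simp: ac_simps)
    also have "\<dots> \<le> norm x0 + B / (2 * L)"
    proof -
      have "exp (- 2 * L * u) * norm x0 \<le> 1 * norm x0"
        by (rule mult_right_mono) (use u L in auto)
      moreover have "2 * L * u \<le> exp (2 * L * u)" using exp_ge_add_one_self[of "2*L*u"] by linarith
      then have "exp (- 2 * L * u) * (B * u) \<le> B / (2 * L)"
        using L B0 by (simp add: exp_minus field_simps mult_left_mono)
      ultimately show ?thesis by (simp add: algebra_simps)
    qed
    finally show "norm (J g (max 0 t)) \<le> norm x0 + B / (2 * L)" by (simp add: u_def)
  qed
  define P where "P g = Bcontfun (\<lambda>t. J g (max 0 t))" for g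
  have Papp: "apply_bcontfun (P g) t = J g (max 0 t)" for g t
    unfolding P_def by (simp add: Bcontfun_inverse JB)
  have "\<exists>!g. P g = g"
  proof (rule banach_fix_type[of "1/2"], safe)
    fix f g
    show "dist (P f) (P g) \<le> 1/2 * dist f g"
    proof (rule dist_bound)
      fix t :: real
      define u where "u = max 0 t"
      have u: "u \<ge> 0" by (simp add: u_def)
      define D where "D = dist f g"
      have D: "norm (apply_bcontfun f s - apply_bcontfun g s) \<le> D" for s
        using dist_bounded[of f s g] by (simp add: D_def dist_norm)
      have D0: "D \<ge> 0" by (simp add: D_def)
      have "((\<lambda>s. L * D * exp (2 * L * s)) has_integral
              (D / 2 * exp (2 * L * u) - D / 2 * exp (2 * L * 0))) {0..u}"
        by (rule fundamental_theorem_of_calculus[OF u])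
          (use L in \<open>auto intro!: derivative_eq_intros
              simp: has_real_derivative_iff_has_vector_derivative[symmetric]\<close>)
      then have I: "integral {0..u} (\<lambda>s. L * D * exp (2 * L * s)) = D / 2 * (exp (2 * L * u) - 1)"
        and Ii: "(\<lambda>s. L * D * exp (2 * L * s)) integrable_on {0..u}"
        by (auto simp: has_integral_iff algebra_simps)
      have hd: "norm (h f s - h g s) \<le> L * D * exp (2 * L * s)" for s
      proof -
        have "norm (h f s - h g s) \<le> L * norm (exp (2 * L * s) *\<^sub>R (apply_bcontfun f s - apply_bcontfun g s))"
          unfolding h_def scaleR_diff_right by (rule lip)
        also have "\<dots> \<le> L * (exp (2 * L * s) * D)"
          using L D[of s] by (auto intro!: mult_left_mono)
        finally show ?thesis by (simp add: ac_simps)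
      qed
      have "J f u - J g u = exp (- 2 * L * u) *\<^sub>R integral {0..u} (\<lambda>s. h f s - h g s)"
        unfolding J_def by (simp add: integral_diff inth algebra_simps)
      also have "norm \<dots> \<le> exp (- 2 * L * u) * (D / 2 * (exp (2 * L * u) - 1))"
      proof -
        have "norm (integral {0..u} (\<lambda>s. h f s - h g s)) \<le> D / 2 * (exp (2 * L * u) - 1)"
          unfolding I[symmetric]
          by (rule integral_norm_bound_integral[OF integrable_diff[OF inth inth] Ii hd])
        then show ?thesis by simp
      qed
      also have "\<dots> \<le> 1/2 * D"
        using D0 by (simp add: exp_minus field_simps)
      finally show "dist (apply_bcontfun (P f) t) (apply_bcontfun (P g) t) \<le> 1/2 * dist f g"
        by (simp add: Papp dist_norm u_def D_def)
    qed
  qed auto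
  then obtain g where g: "P g = g" by blast
  define x where "x t = x0 + integral {0..t} (h g)" for t
  have "apply_bcontfun g t = exp (- 2 * L * t) *\<^sub>R x t" if "t \<ge> 0" for t
    using Papp[of g t] that unfolding g J_def x_def by simp
  then have hx: "h g t = F (x t)" if "t \<ge> 0" for t
    using that unfolding h_def by (simp add: exp_minus)
  show thesis
  proof
    show "x 0 = x0" by (simp add: x_def)
    show "(x has_vector_derivative F (x t)) (at t within {0..})" if "t \<ge> 0" for t
      unfolding x_def[abs_def] using derh[OF that, of g] hx[OF that]
      by (auto intro!: derivative_eq_intros simp: x_def)
  qed
qed

section \<open>Scalar differential inequalities with one-sided derivatives\<close>

lemma deriv_ge_imp_increment_ge:
  fixes f :: "real \<Rightarrow> real"
  assumes f: "\<And>t. t \<in> {a..b} \<Longrightarrow> (f has_real_derivative f' t) (at t within S)"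
    and S: "{a..b} \<subseteq> S" and ab: "a \<le> b" and ge: "\<And>t. t \<in> {a..b} \<Longrightarrow> c \<le> f' t"
  shows "c * (b - a) \<le> f b - f a"
proof (cases "a = b")
  case False
  have "\<exists>x\<in>{a<..<b}. f b - f a = f' x * (b - a)"
  proof (rule mvt_simple)
    show "(f has_derivative (*) (f' x)) (at x within {a..b})" if "a \<le> x" "x \<le> b" for x
      using has_derivative_subset[OF f[unfolded has_field_derivative_def] S] that by auto
  qed (use ab False in auto)
  then obtain x where "x \<in> {a<..<b}" "f b - f a = f' x * (b - a)" by blast
  then show ?thesis using ge[of x] by (auto intro!: mult_right_mono)
qed simp

text \<open>After the last time with f >= 0 the function is negative, hence non-decreasing, and
  continuity leaves it no way to have become negative. The sign condition holds on the whole region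
  f <= 0, so equality f' = 0 at the barrier does no harm.\<close>

lemma nonneg_barrier:
  fixes f :: "real \<Rightarrow> real"
  assumes f: "\<And>t. t \<ge> 0 \<Longrightarrow> (f has_real_derivative f' t) (at t within {0..})"
    and f0: "f 0 \<ge> 0" and f': "\<And>t. t \<ge> 0 \<Longrightarrow> f t \<le> 0 \<Longrightarrow> f' t \<ge> 0" and t: "t \<ge> 0"
  shows "f t \<ge> 0"
proof (rule ccontr)
  assume neg: "\<not> f t \<ge> 0"
  have cont: "continuous_on {0..} f"
    by (rule DERIV_continuous_on[of _ _ f']) (use f in auto)
  define S where "S = {0..t} \<inter> f -` {0..}"
  have "closed S"
    unfolding S_def
    by (rule continuous_closed_preimage) (auto intro: continuous_on_subset[OF cont])
  then have "compact S"
    by (metis S_def compact_Int_closed compact_Icc inf.left_idem)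
  moreover have "0 \<in> S" using f0 t by (simp add: S_def)
  ultimately obtain s where s: "s \<in> S" "\<And>r. r \<in> S \<Longrightarrow> r \<le> s"
    using compact_attains_sup[of S] by blast
  have s0: "0 \<le> s" "s \<le> t" "f s \<ge> 0" using s(1) by (auto simp: S_def)
  have below: "f r < 0" if "s < r" "r \<le> t" for r
  proof (rule ccontr)
    assume "\<not> f r < 0"
    then have "r \<in> S" using that s0 by (simp add: S_def)
    then show False using s(2) that by fastforce
  qed
  show False
  proof (cases "f s = 0")
    case True
    have "0 * (t - s) \<le> f t - f s"
    proof (rule deriv_ge_imp_increment_ge[where f' = f' and S = "{0..}"])
      show "0 \<le> f' r" if "r \<in> {s..t}" for r
        using f'[of r] below[of r] True that s0 by (cases "r = s") auto
    qed (use f s0 in auto)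
    then show False using True neg by simp
  next
    case False
    then have "f s > 0" using s0 by simp
    moreover have "continuous_on {s..t} f"
      by (rule continuous_on_subset[OF cont]) (use s0 in auto)
    ultimately obtain r where "s \<le> r" "r \<le> t" "f r = 0"
      using IVT2'[of f t 0 s] neg s0 by force
    then show False using below[of r] False by (cases "r = s") auto
  qed
qed

section \<open>Finite truncations\<close>

text \<open>Abel summation. With g the energy flux, which vanishes at both ends of a truncation, w =
  1 gives conservation of energy, and w = p^2 gives monotonicity of weighted energies with the sign
  of 1 - p^2.\<close>

lemma weighted_telescope:
  fixes g :: "nat \<Rightarrow> real"
  shows "(\<Sum>k=1..n. w ^ k * (g k - g (k - 1))) =
    (1 - w) * (\<Sum>k=1..n. w ^ k * g k) + w ^ (n + 1) * g n - w * g 0"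
  by (induction n) (auto simp: algebra_simps)

text \<open>Clipping makes the truncated field bounded and globally Lipschitz; the clipped solution turns out
  to stay in \<open>[0, 1]\<close>, where clipping is the identity.\<close>

definition clip :: "real \<Rightarrow> real" where
  "clip x = max 0 (min 1 x)"

lemma clip_bounds: "0 \<le> clip x" "clip x \<le> 1"
  by (auto simp: clip_def)

lemma clip_eq: "0 \<le> x \<Longrightarrow> x \<le> 1 \<Longrightarrow> clip x = x"
  by (auto simp: clip_def)

lemma clip_lipschitz: "\<bar>clip x - clip y\<bar> \<le> \<bar>x - y\<bar>"
  by (auto simp: clip_def)

lemma clip_mult_lipschitz:
  "\<bar>clip x * clip y - clip x' * clip y'\<bar> \<le> \<bar>x - x'\<bar> + \<bar>y - y'\<bar>"
proof -
  have "clip x * clip y - clip x' * clip y' = clip x * (clip y - clip y') + (clip x - clip x') * clip y'"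
    by (simp add: algebra_simps)
  also have "\<bar>\<dots>\<bar> \<le> \<bar>clip x\<bar> * \<bar>clip y - clip y'\<bar> + \<bar>clip x - clip x'\<bar> * \<bar>clip y'\<bar>"
    by (rule order_trans[OF abs_triangle_ineq]) (simp add: abs_mult)
  also have "\<dots> \<le> 1 * \<bar>y - y'\<bar> + \<bar>x - x'\<bar> * 1"
    by (intro add_mono mult_mono clip_lipschitz) (auto simp: clip_bounds)
  finally show ?thesis by simp
qed

definition clipped_field :: "real \<Rightarrow> nat \<Rightarrow> (nat \<Rightarrow> real) \<Rightarrow> nat \<Rightarrow> real" where
  "clipped_field \<mu> n x k = (if 1 \<le> k \<and> k \<le> n
     then \<mu> ^ k * (clip (x (k + 1)))\<^sup>2 - \<mu> ^ (k - 1) * clip (x (k - 1)) * clip (x k) else 0)"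

lemma clipped_field_bounded:
  assumes "\<mu> > 1" shows "\<bar>clipped_field \<mu> n x k\<bar> \<le> \<mu> ^ n"
proof (cases "1 \<le> k \<and> k \<le> n")
  case True
  have "\<mu> ^ j * (clip a * clip b) \<le> \<mu> ^ n * 1" "0 \<le> \<mu> ^ j * (clip a * clip b)" if "j \<le> n" for j a b
    using that assms clip_bounds[of a] clip_bounds[of b]
    by (intro mult_mono power_increasing mult_le_one mult_nonneg_nonneg; simp)+
  from this[of k "x (k+1)" "x (k+1)"] this[of "k-1" "x (k-1)" "x k"] True
  show ?thesis
    unfolding clipped_field_def power2_eq_square mult.assoc abs_le_iff
    by (simp; linarith)
qed (use assms in \<open>auto simp: clipped_field_def\<close>)

lemma clipped_field_lipschitz:
  assumes "\<mu> > 1" and d: "\<And>k. \<bar>x k - y k\<bar> \<le> d"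
  shows "\<bar>clipped_field \<mu> n x k - clipped_field \<mu> n y k\<bar> \<le> 4 * \<mu> ^ n * d"
proof (cases "1 \<le> k \<and> k \<le> n")
  case True
  have *: "\<mu> ^ j * \<bar>clip (x a) * clip (x b) - clip (y a) * clip (y b)\<bar> \<le> \<mu> ^ n * (2 * d)"
    if "j \<le> n" for j a b
    using that assms(1) d[of a] d[of b] clip_mult_lipschitz[of "x a" "x b" "y a" "y b"]
    by (intro mult_mono power_increasing) auto
  have "clipped_field \<mu> n x k - clipped_field \<mu> n y k =
      \<mu> ^ k * (clip (x (k+1)) * clip (x (k+1)) - clip (y (k+1)) * clip (y (k+1)))
    - \<mu> ^ (k-1) * (clip (x (k-1)) * clip (x k) - clip (y (k-1)) * clip (y k))"
    using True by (simp add: clipped_field_def power2_eq_square algebra_simps)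
  also have "\<bar>\<dots>\<bar> \<le> \<mu> ^ k * \<bar>clip (x (k+1)) * clip (x (k+1)) - clip (y (k+1)) * clip (y (k+1))\<bar>
    + \<mu> ^ (k-1) * \<bar>clip (x (k-1)) * clip (x k) - clip (y (k-1)) * clip (y k)\<bar>"
    using assms(1) by (intro order_trans[OF abs_triangle_ineq4]) (simp add: abs_mult)
  also have "\<dots> \<le> \<mu> ^ n * (2 * d) + \<mu> ^ n * (2 * d)"
    by (intro add_mono *) (use True in auto)
  finally show ?thesis by (simp add: ac_simps)
next
  case False
  have "0 \<le> d" using d[of 0] by (rule order_trans[OF abs_ge_zero])
  then have "0 \<le> 4 * \<mu> ^ n * d" using assms(1) by simp
  then show ?thesis using False by (auto simp: clipped_field_def)
qed

instance bcontfun :: (metric_space, banach) banach ..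

text \<open>The dimension n is a variable, so no fixed Euclidean type fits. Sequences are treated as
  bounded functions on the discrete space of naturals, a Banach space in the sup norm; each
  coordinate is a bounded linear map, and so derivatives pass to components.\<close>

lemma clipped_solution_exists:
  fixes x0 :: "nat \<Rightarrow> real"
  assumes mu: "\<mu> > 1" and x0: "\<And>k. \<bar>x0 k\<bar> \<le> b"
  obtains z :: "real \<Rightarrow> nat \<Rightarrow> real" where "z 0 = x0"
    and "\<And>k t. t \<ge> 0 \<Longrightarrow>
      ((\<lambda>u. z u k) has_real_derivative clipped_field \<mu> n (z t) k) (at t within {0..})"
proof -
  define seq :: "(nat discrete \<Rightarrow>\<^sub>C real) \<Rightarrow> nat \<Rightarrow> real"
    where "seq x k = apply_bcontfun x (discrete k)" for x k
  define bc :: "(nat \<Rightarrow> real) \<Rightarrow> (nat discrete \<Rightarrow>\<^sub>C real)"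
    where "bc f = Bcontfun (\<lambda>i. f (of_discrete i))" for f
  have seq_bc: "seq (bc f) = f" if "\<And>k. \<bar>f k\<bar> \<le> c" for f c
  proof -
    have "(\<lambda>i. f (of_discrete i)) \<in> bcontfun"
    proof (rule bcontfun_normI)
      show "continuous_on UNIV (\<lambda>i. f (of_discrete i))"
        unfolding continuous_on_open_invariant by (auto intro: open_discrete)
    qed (use that in auto)
    then show ?thesis
      by (simp add: seq_def bc_def Bcontfun_inverse discrete_inverse fun_eq_iff)
  qed
  have seq_le: "\<bar>seq x k\<bar> \<le> norm x" for x k
    using norm_bounded[of x "discrete k"] by (simp add: seq_def)
  have le_seq: "norm x \<le> c" if "\<And>k. \<bar>seq x k\<bar> \<le> c" for x c
  proof (rule norm_bound)
    fix i show "norm (apply_bcontfun x i) \<le> c"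
      using that[of "of_discrete i"] by (simp add: seq_def of_discrete_inverse)
  qed
  have seq_diff: "seq (x - y) k = seq x k - seq y k" for x y k
    by (simp add: seq_def minus_bcontfun.rep_eq)
  have seq_linear: "bounded_linear (\<lambda>x. seq x k)" for k
    by (rule bounded_linear_intro[where K = 1])
      (use seq_le[of _ k] in \<open>auto simp: seq_def plus_bcontfun.rep_eq scaleR_bcontfun.rep_eq\<close>)
  define F where "F x = bc (clipped_field \<mu> n (seq x))" for x
  have F: "seq (F x) = clipped_field \<mu> n (seq x)" for x
    unfolding F_def by (rule seq_bc) (rule clipped_field_bounded[OF mu])
  obtain x where x: "x 0 = bc x0"
    "\<And>t. t \<ge> 0 \<Longrightarrow> (x has_vector_derivative F (x t)) (at t within {0..})"
  proof (rule picard_global[of "4 * \<mu> ^ n" F "\<mu> ^ n" "bc x0"])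
    show "norm (F x - F y) \<le> 4 * \<mu> ^ n * norm (x - y)" for x y
      by (rule le_seq, unfold seq_diff F, rule clipped_field_lipschitz[OF mu])
        (metis seq_diff seq_le)
    show "norm (F x) \<le> \<mu> ^ n" for x
      by (rule le_seq) (simp add: F clipped_field_bounded[OF mu])
  qed (use mu in auto)
  show thesis
  proof
    show "seq (x 0) = x0" by (simp add: x seq_bc[OF x0])
    show "((\<lambda>u. seq (x u) k) has_real_derivative
        clipped_field \<mu> n (seq (x t)) k) (at t within {0..})" if "t \<ge> 0" for k t
      using bounded_linear.has_vector_derivative[OF seq_linear[of k] x(2)[OF that]]
      by (simp add: F has_real_derivative_iff_has_vector_derivative)
  qed
qed

text \<open>The function is x^2/2 up to 1 and x - 1/2 beyond. It supplies the energy density of the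
  clipped system, to be used before the clipping is known to be inactive. Only the kink of
  \<open>max\<close> requires a limit computed by hand.\<close>

lemma clip_primitive_deriv:
  "((\<lambda>x. x\<^sup>2 / 2 - (max 0 (x - 1))\<^sup>2 / 2) has_real_derivative min 1 x) (at x)" for x :: real
proof -
  have pos: "((\<lambda>x. (max 0 x)\<^sup>2) has_real_derivative 2 * max 0 x) (at x)" for x :: real
  proof (cases x "0 :: real" rule: linorder_cases)
    case less
    have "((\<lambda>x. 0) has_real_derivative 2 * max 0 x) (at x)" using less by (auto intro!: derivative_eq_intros)
    then show ?thesis
      by (rule has_field_derivative_transform_within_open[of _ _ _ "{..<0}"]) (use less in auto)
  next
    case greater
    have "((\<lambda>x. x\<^sup>2) has_real_derivative 2 * max 0 x) (at x)" using greater by (auto intro!: derivative_eq_intros)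
    then show ?thesis
      by (rule has_field_derivative_transform_within_open[of _ _ _ "{0<..}"]) (use greater in auto)
  next
    case equal
    have "((\<lambda>h::real. (max 0 h)\<^sup>2 / h) \<longlongrightarrow> 0) (at 0)"
    proof (rule Lim_null_comparison)
      show "\<forall>\<^sub>F h in at 0. norm ((max 0 h)\<^sup>2 / h) \<le> \<bar>h::real\<bar>"
        by (auto simp: eventually_at_filter max_def power2_eq_square)
      show "((\<lambda>h::real. \<bar>h\<bar>) \<longlongrightarrow> 0) (at 0)" by (intro tendsto_eq_intros) auto
    qed
    then show ?thesis using equal by (simp add: DERIV_def)
  qed
  have "((\<lambda>x. (max 0 (x - 1))\<^sup>2) has_real_derivative 2 * max 0 (x - 1) * 1) (at x)"
    by (rule DERIV_chain2[OF pos]) (auto intro!: derivative_eq_intros)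
  moreover have "((\<lambda>x. x\<^sup>2) has_real_derivative 2 * x) (at x)"
    by (auto intro!: derivative_eq_intros)
  ultimately have "((\<lambda>x. x\<^sup>2 / 2 - (max 0 (x - 1))\<^sup>2 / 2) has_real_derivative
      2 * x / 2 - 2 * max 0 (x - 1) * 1 / 2) (at x)"
    by (intro DERIV_diff DERIV_cdivide)
  also have "2 * x / 2 - 2 * max 0 (x - 1) * 1 / 2 = min 1 x"
    by (auto simp: max_def min_def)
  finally show ?thesis .
qed

text \<open>The equation is imposed for every k >= 1, also above n: there each term contains a mode
  above n and vanishes. A truncation is thus an exact solution of the full system, and the limit has
  no truncation error to remove.\<close>

locale galerkin =
  fixes \<mu> :: real and n :: nat and z :: "real \<Rightarrow> nat \<Rightarrow> real"
  assumes mu: "\<mu> > 1" and n: "n \<ge> 1"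
    and init: "z 0 k = (if k = n then 1 else 0)"
    and nonneg: "t \<ge> 0 \<Longrightarrow> 0 \<le> z t k"
    and boundary: "t \<ge> 0 \<Longrightarrow> z t 0 = 0"
    and above: "t \<ge> 0 \<Longrightarrow> k > n \<Longrightarrow> z t k = 0"
    and ode: "t \<ge> 0 \<Longrightarrow> k \<ge> 1 \<Longrightarrow> ((\<lambda>u. z u k) has_real_derivative
      \<mu> ^ k * (z t (k + 1))\<^sup>2 - \<mu> ^ (k - 1) * z t (k - 1) * z t k) (at t within {0..})"

lemma galerkin_exists:
  assumes mu: "\<mu> > 1" and n: "n \<ge> 1"
  obtains z where "galerkin \<mu> n z"
proof -
  obtain z where z0: "z 0 = (\<lambda>k. if k = n then 1 else (0::real))"
    and der: "\<And>k t. t \<ge> 0 \<Longrightarrow>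
      ((\<lambda>u. z u k) has_real_derivative clipped_field \<mu> n (z t) k) (at t within {0..})"
    by (rule clipped_solution_exists[OF mu, of "\<lambda>k. if k = n then 1 else (0::real)" 1 n]) auto
  have const: "z t k = z 0 k" if "t \<ge> 0" "\<not> (1 \<le> k \<and> k \<le> n)" for t k
  proof -
    have "\<exists>c. \<forall>t\<in>{0..}. z t k = c"
    proof (rule has_field_derivative_zero_constant)
      show "((\<lambda>u. z u k) has_real_derivative 0) (at t within {0..})" if "t \<in> {0..}" for t
        using der[of t k] that \<open>\<not> _\<close> by (auto simp: clipped_field_def)
    qed auto
    then show ?thesis using that by auto
  qed
  have boundary: "z t 0 = 0" if "t \<ge> 0" for t using const[OF that, of 0] n by (simp add: z0)
  have above: "z t k = 0" if "t \<ge> 0" "k > n" for t k using const[of t k] that by (simp add: z0)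
  have nonneg: "z t k \<ge> 0" if "t \<ge> 0" for t k
  proof (rule nonneg_barrier[OF der _ _ that])
    show "0 \<le> clipped_field \<mu> n (z t) k" if "z t k \<le> 0" for t
      using that mu by (auto simp: clipped_field_def clip_def)
  qed (auto simp: z0)
  \<comment> \<open>\<open>\<Phi>' = clip\<close> on non-negative reals, so that \<open>\<Sum> \<Phi> (z_k)\<close> is conserved by the clipped system\<close>
  define \<Phi> :: "real \<Rightarrow> real" where "\<Phi> x = x\<^sup>2 / 2 - (max 0 (x - 1))\<^sup>2 / 2" for x
  have \<Phi>nn: "\<Phi> x \<ge> 0" if "x \<ge> 0" for x
    using that power_mono[of "max 0 (x-1)" x 2] by (auto simp: \<Phi>_def)
  have \<Phi>1: "x \<le> 1" if "\<Phi> x \<le> 1/2" for x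
  proof (rule ccontr)
    assume "\<not> x \<le> 1"
    then have "\<Phi> x = x - 1/2" by (simp add: \<Phi>_def power2_eq_square field_simps)
    then show False using that \<open>\<not> x \<le> 1\<close> by simp
  qed
  have clip_min: "min 1 (z t k) = clip (z t k)" if "t \<ge> 0" for t k
    using nonneg[OF that, of k] by (auto simp: clip_def)
  define g where "g t k = \<mu> ^ k * clip (z t k) * (clip (z t (k + 1)))\<^sup>2" for t k
  have "\<exists>c. \<forall>t\<in>{0..}. (\<Sum>k=1..n. \<Phi> (z t k)) = c"
  proof (rule has_field_derivative_zero_constant)
    fix t :: real assume t: "t \<in> {0..}"
    have "((\<lambda>u. \<Phi> (z u k)) has_real_derivative min 1 (z t k) * clipped_field \<mu> n (z t) k)
      (at t within {0..})" for k
      unfolding \<Phi>_def by (rule DERIV_chain2[OF clip_primitive_deriv der]) (use t in auto)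
    then have "((\<lambda>u. \<Sum>k=1..n. \<Phi> (z u k)) has_real_derivative
      (\<Sum>k=1..n. min 1 (z t k) * clipped_field \<mu> n (z t) k)) (at t within {0..})"
      by (intro DERIV_sum)
    also have "(\<Sum>k=1..n. min 1 (z t k) * clipped_field \<mu> n (z t) k) = (\<Sum>k=1..n. 1 ^ k * (g t k - g t (k - 1)))"
    proof (rule sum.cong)
      fix k assume "k \<in> {1..n}"
      then show "min 1 (z t k) * clipped_field \<mu> n (z t) k = 1 ^ k * (g t k - g t (k - 1))"
        using t clip_min[of t k]
        by (simp add: clipped_field_def g_def power2_eq_square algebra_simps)
    qed simp
    also have "\<dots> = 0"
      unfolding weighted_telescope
      using t boundary[of t] above[of t "n+1"] by (simp add: g_def clip_def)
    finally show "((\<lambda>u. \<Sum>k=1..n. \<Phi> (z u k)) has_real_derivative 0) (at t within {0..})" .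
  qed auto
  then have \<Phi>sum: "(\<Sum>k=1..n. \<Phi> (z t k)) = (\<Sum>k=1..n. \<Phi> (z 0 k))" if "t \<ge> 0" for t
    using that by auto
  have "(\<Sum>k=1..n. \<Phi> (z 0 k)) = (\<Sum>k=1..n. if k = n then 1/2 else 0)"
    by (intro sum.cong) (auto simp: \<Phi>_def z0)
  also have "\<dots> = 1/2" using n by simp
  finally have \<Phi>init: "(\<Sum>k=1..n. \<Phi> (z 0 k)) = 1/2" .
  \<comment> \<open>The conserved total is 1/2, the value of \<Phi> at 1. Since all summands are
    non-negative, a single component above 1 would already exceed it.\<close>
  have le1: "z t k \<le> 1" if t: "t \<ge> 0" for t k
  proof (cases "k \<in> {1..n}")
    case True
    have "\<Phi> (z t k) \<le> (\<Sum>k=1..n. \<Phi> (z t k))"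
      by (rule member_le_sum[OF True]) (use \<Phi>nn nonneg[OF t] in auto)
    then show ?thesis using \<Phi>1 \<Phi>sum[OF t] \<Phi>init by simp
  next
    case False
    then show ?thesis using const[OF t, of k] by (auto simp: z0)
  qed
  have clip_id: "clip (z t k) = z t k" if "t \<ge> 0" for t k
    using clip_eq[OF nonneg[OF that] le1[OF that]] .
  have "galerkin \<mu> n z"
  proof
    show "((\<lambda>u. z u k) has_real_derivative
      \<mu> ^ k * (z t (k + 1))\<^sup>2 - \<mu> ^ (k - 1) * z t (k - 1) * z t k) (at t within {0..})"
      if "t \<ge> 0" "k \<ge> 1" for t k
    proof (cases "k \<le> n")
      case True
      then show ?thesis using der[of t k] that by (simp add: clipped_field_def clip_id)
    next
      case False
      then show ?thesis using der[of t k] that above[of t] by (simp add: clipped_field_def)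
    qed
  qed (use mu n z0 nonneg boundary above in auto)
  then show thesis by (rule that)
qed

section \<open>Smoothing uniform in the truncation\<close>

lemma sum_shift_up:
  fixes f :: "nat \<Rightarrow> real"
  shows "(\<Sum>k=1..n. f (k + 1)) = (\<Sum>k=1..n. f k) + f (n + 1) - f 1"
  by (induction n) auto

lemma sum_shift_down:
  fixes f :: "nat \<Rightarrow> real"
  shows "(\<Sum>k=1..n. f (k - 1)) = (\<Sum>k=1..n. f k) + f 0 - f n"
  by (induction n) auto

lemma geometric_partial_sum_le:
  fixes a :: real
  assumes "0 \<le> a" "a < 1"
  shows "(\<Sum>k=1..n. a ^ k) \<le> 1 / (1 - a)"
proof -
  have "(\<Sum>k=1..n. a ^ k) \<le> (\<Sum>k. a ^ k)"
    by (rule sum_le_suminf) (use assms in \<open>auto intro!: summable_geometric\<close>)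
  then show ?thesis using assms by (simp add: suminf_geometric)
qed

section \<open>Weighted energies of a truncation\<close>

context galerkin
begin

text \<open>Half the rate at which energy passes from mode k + 1 to mode k.\<close>

definition flux :: "real \<Rightarrow> nat \<Rightarrow> real" where
  "flux t k = \<mu> ^ k * z t k * (z t (k + 1))\<^sup>2"

lemma flux_nonneg: "t \<ge> 0 \<Longrightarrow> 0 \<le> flux t k"
  using mu nonneg by (simp add: flux_def)

text \<open>For p = \<open>lam powr s\<close> this is the squared H^s norm of the
  truncation.\<close>

definition wsum :: "real \<Rightarrow> real \<Rightarrow> real" where
  "wsum p t = (\<Sum>k=1..n. (p ^ k * z t k)\<^sup>2)"

text \<open>Transfer towards low modes raises an energy whose weights decrease in k and lowers one
  whose weights increase. For p other than 1, bounds on \<open>wsum p\<close> therefore bound the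
  time integral of the weighted flux.\<close>

lemma wsum_deriv:
  assumes t: "t \<ge> 0"
  shows "(wsum p has_real_derivative 2 * (1 - p\<^sup>2) * (\<Sum>k=1..n. (p\<^sup>2) ^ k * flux t k)) (at t within {0..})"
proof -
  have "(wsum p has_real_derivative (\<Sum>k=1..n. 2 * (p\<^sup>2) ^ k * z t k *
      (\<mu> ^ k * (z t (k + 1))\<^sup>2 - \<mu> ^ (k - 1) * z t (k - 1) * z t k))) (at t within {0..})"
    unfolding wsum_def
    by (intro DERIV_sum)
      (auto intro!: derivative_eq_intros ode[OF t] simp: power2_eq_square power_mult_distrib)
  also have "(\<Sum>k=1..n. 2 * (p\<^sup>2) ^ k * z t k *
      (\<mu> ^ k * (z t (k + 1))\<^sup>2 - \<mu> ^ (k - 1) * z t (k - 1) * z t k))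
    = 2 * (\<Sum>k=1..n. (p\<^sup>2) ^ k * (flux t k - flux t (k - 1)))"
    unfolding sum_distrib_left
    by (intro sum.cong) (auto simp: flux_def power2_eq_square algebra_simps)
  also have "\<dots> = 2 * (1 - p\<^sup>2) * (\<Sum>k=1..n. (p\<^sup>2) ^ k * flux t k)"
    unfolding weighted_telescope using t boundary above[of t "n+1"] by (simp add: flux_def)
  finally show ?thesis .
qed

lemma energy:
  assumes "t \<ge> 0" shows "(\<Sum>k=1..n. (z t k)\<^sup>2) = 1"
proof -
  have "\<exists>c. \<forall>t\<in>{0..}. wsum 1 t = c"
    by (rule has_field_derivative_zero_constant) (use wsum_deriv[of _ 1] in auto)
  then have "wsum 1 t = wsum 1 0" using assms by auto
  also have "wsum 1 0 = (\<Sum>k=1..n. if k = n then 1 else 0)"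
    unfolding wsum_def by (intro sum.cong) (auto simp: init)
  also have "\<dots> = 1" using n by simp
  finally show ?thesis by (simp add: wsum_def)
qed

lemma le_1:
  assumes "t \<ge> 0" shows "z t k \<le> 1"
proof (cases "k \<in> {1..n}")
  case True
  have "(z t k)\<^sup>2 \<le> (\<Sum>k=1..n. (z t k)\<^sup>2)"
    by (rule member_le_sum[OF True]) auto
  then show ?thesis using energy[OF assms] power2_le_imp_le[of "z t k" 1] by simp
next
  case False
  then show ?thesis using boundary above assms by (cases "k = 0") auto
qed

text \<open>This turns an average over a time window into a bound at its right end.\<close>

lemma wsum_antimono:
  assumes "r \<ge> 1" "0 \<le> s" "s \<le> t" shows "wsum r t \<le> wsum r s"
proof -
  have "0 * (t - s) \<le> - wsum r t - - wsum r s"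
  proof (rule deriv_ge_imp_increment_ge[where S = "{0..}"])
    fix u assume u: "u \<in> {s..t}"
    show "((\<lambda>t. - wsum r t) has_real_derivative
      - (2 * (1 - r\<^sup>2) * (\<Sum>k=1..n. (r\<^sup>2) ^ k * flux u k))) (at u within {0..})"
      by (intro DERIV_minus wsum_deriv) (use u assms in auto)
    have "0 \<le> (r\<^sup>2 - 1) * (\<Sum>k=1..n. (r\<^sup>2) ^ k * flux u k)"
      using u assms by (intro mult_nonneg_nonneg sum_nonneg flux_nonneg) auto
    then show "0 \<le> - (2 * (1 - r\<^sup>2) * (\<Sum>k=1..n. (r\<^sup>2) ^ k * flux u k))"
      by (simp add: algebra_simps)
  qed (use assms in auto)
  then show ?thesis by simp
qed


text \<open>C >= 1 lets C stand in for its square root and keeps later constants free of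
  roots.\<close>

lemma le_of_wsum_le:
  assumes t: "t \<ge> 0" and p: "p > 0" and C: "wsum p t \<le> C" "C \<ge> 1"
  shows "z t k \<le> C / p ^ k"
proof (cases "k \<in> {1..n}")
  case True
  have "(p ^ k * z t k)\<^sup>2 \<le> wsum p t"
    unfolding wsum_def by (rule member_le_sum[OF True]) auto
  also have "\<dots> \<le> C * C" using C mult_left_mono[of 1 C C] by linarith
  finally have "p ^ k * z t k \<le> C"
    using power2_le_imp_le[of "p ^ k * z t k" C] C by (simp add: power2_eq_square)
  then show ?thesis using p by (simp add: field_simps)
next
  case False
  then have "z t k = 0" using boundary[OF t] above[OF t] by (cases "k = 0") auto
  then show ?thesis using p C by simp
qed

text \<open>The derivative of a suitable combination of \<open>\<Sum> (\<rho>/\<mu>)^k z_k\<close> and of the lower-order energy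
  \<open>wsum p\<close> controls the higher-order energy \<open>wsum r\<close>: the linear functional produces \<open>wsum r\<close> itself,
  and by Young's inequality its remaining term is absorbed by the flux in the derivative of
  \<open>wsum p\<close>.\<close>

lemma smoothing_step:
  assumes p: "0 < p" "p < \<mu>" "p \<noteq> 1" and r: "r > 1" "r ^ 4 < p ^ 3 * \<mu>"
    and h: "h > 0" "h \<le> t" and C: "C \<ge> 1" "\<And>s. s \<in> {t-h..t} \<Longrightarrow> wsum p s \<le> C"
  defines "a \<equiv> r\<^sup>2 / (\<mu> * p)" and "b \<equiv> r ^ 4 / (p ^ 3 * \<mu>)" and "\<rho> \<equiv> r\<^sup>2"
  shows "wsum r t \<le> \<rho> + \<rho> ^ 3 / \<mu> * (C / (1 - b))
    + 2 * (\<rho> * (C / (1 - a)) + \<rho> / \<mu> / (2 * \<bar>1 - p\<^sup>2\<bar>) * C) / h"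
proof -
  have mu0: "\<mu> > 0" using mu by simp
  have \<rho>: "\<rho> > 0" using r by (simp add: \<rho>_def)
  \<comment> \<open>a and b are the ratios of the geometric series that bound the linear functional
    and the remainder in Young's inequality. b < 1 is the assumption on r; a < 1 follows from it
    because p < \<mu>.\<close>
  have b: "0 \<le> b" "b < 1" using p r mu0 by (auto simp: b_def)
  have a: "0 \<le> a" "a < 1"
  proof -
    have "(r\<^sup>2)\<^sup>2 < p ^ 3 * \<mu>" using r(2) by (simp flip: power_mult)
    also have "p ^ 3 * \<mu> = (p\<^sup>2 * \<mu>) * p" by (simp add: power2_eq_square power3_eq_cube)
    also have "\<dots> \<le> (p\<^sup>2 * \<mu>) * \<mu>" using p mu0 by (intro mult_left_mono) auto
    also have "\<dots> = (\<mu> * p)\<^sup>2" by (simp add: power2_eq_square)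
    finally have "r\<^sup>2 < \<mu> * p" by (rule power_less_imp_less_base) (use p mu0 in auto)
    then show "a < 1" using p mu0 by (simp add: a_def)
    show "0 \<le> a" using p mu0 by (simp add: a_def)
  qed
  define \<kappa> where "\<kappa> = 1 - p\<^sup>2"
  have \<kappa>: "\<kappa> \<noteq> 0" using p by (auto simp: \<kappa>_def power2_eq_1_iff)
  define C1 where "C1 = \<rho> + \<rho> ^ 3 / \<mu> * (C / (1 - b))"
  define C2 where "C2 = \<rho> * (C / (1 - a)) + \<rho> / \<mu> / (2 * \<bar>\<kappa>\<bar>) * C"
  have pos: "s \<ge> 0" if "s \<in> {t-h..t}" for s using that h by simp
  have weighted: "(\<Sum>k=1..n. v ^ k * z s k) \<le> C / (1 - v / p)"
    if s: "s \<in> {t-h..t}" and v: "0 \<le> v" "v / p < 1" for s v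
  proof -
    have "(\<Sum>k=1..n. v ^ k * z s k) \<le> (\<Sum>k=1..n. C * (v / p) ^ k)"
    proof (rule sum_mono)
      fix k
      have "v ^ k * z s k \<le> v ^ k * (C / p ^ k)"
        using v le_of_wsum_le[OF pos[OF s] p(1) C(2)[OF s] C(1)] by (intro mult_left_mono) auto
      then show "v ^ k * z s k \<le> C * (v / p) ^ k" by (simp add: power_divide ac_simps)
    qed
    also have "\<dots> \<le> C * (1 / (1 - v / p))"
      unfolding sum_distrib_left[symmetric]
      using v p C by (intro mult_left_mono geometric_partial_sum_le) auto
    finally show ?thesis by simp
  qed
  define V where "V s k = \<mu> ^ k * (z s (k + 1))\<^sup>2 - \<mu> ^ (k - 1) * z s (k - 1) * z s k" for s k
  define L where "L s = (\<Sum>k=1..n. (\<rho> / \<mu>) ^ k * z s k)" for s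
  define D where "D s = (\<Sum>k=1..n. (p\<^sup>2) ^ k * flux s k)" for s
  \<comment> \<open>Division by 2 * \<kappa> normalises the flux term of the derivative to (\<rho> /
    \<mu>) * D, the multiple that absorbs the flux part of M below. The sign of \<kappa> differs for
    p < 1 and p > 1, harmlessly, since only the size of G enters.\<close>
  define G where "G s = \<rho> * L s + \<rho> / \<mu> / (2 * \<kappa>) * wsum p s" for s
  have L: "0 \<le> L s" "L s \<le> C / (1 - a)" if s: "s \<in> {t-h..t}" for s
  proof -
    show "0 \<le> L s" unfolding L_def using \<rho> mu0 nonneg[OF pos[OF s]]
      by (intro sum_nonneg mult_nonneg_nonneg) auto
    have "\<rho> / \<mu> / p = a" by (simp add: \<rho>_def a_def)
    then show "L s \<le> C / (1 - a)"
      using weighted[OF s, of "\<rho> / \<mu>"] a \<rho> mu0 by (simp add: L_def)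
  qed
  have G: "\<bar>G s\<bar> \<le> C2" if s: "s \<in> {t-h..t}" for s
  proof -
    have w: "0 \<le> wsum p s" "wsum p s \<le> C" using C(2)[OF s] by (auto simp: wsum_def intro!: sum_nonneg)
    have "\<bar>G s\<bar> \<le> \<rho> * L s + \<rho> / \<mu> / (2 * \<bar>\<kappa>\<bar>) * wsum p s"
      unfolding G_def using \<rho> mu0 L[OF s] w
      by (intro order_trans[OF abs_triangle_ineq]) (simp add: abs_mult)
    also have "\<dots> \<le> C2"
      unfolding C2_def using \<rho> mu0 L[OF s] w by (intro add_mono mult_left_mono) auto
    finally show ?thesis .
  qed
  have G': "(G has_real_derivative \<rho> * (\<Sum>k=1..n. (\<rho> / \<mu>) ^ k * V s k) + \<rho> / \<mu> * D s)
      (at s within {0..})" if s: "s \<in> {t-h..t}" for s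
  proof -
    have "(L has_real_derivative (\<Sum>k=1..n. (\<rho> / \<mu>) ^ k * V s k)) (at s within {0..})"
      unfolding L_def V_def by (intro DERIV_sum DERIV_cmult ode pos[OF s]) auto
    then have "(G has_real_derivative \<rho> * (\<Sum>k=1..n. (\<rho> / \<mu>) ^ k * V s k)
        + \<rho> / \<mu> / (2 * \<kappa>) * (2 * \<kappa> * D s)) (at s within {0..})"
      unfolding G_def D_def by (intro DERIV_add DERIV_cmult wsum_deriv[where p = p, folded \<kappa>_def] pos[OF s])
    then show ?thesis using \<kappa> mu0 by simp
  qed
  have lower: "wsum r t - C1 \<le> \<rho> * (\<Sum>k=1..n. (\<rho> / \<mu>) ^ k * V s k) + \<rho> / \<mu> * D s"
    if s: "s \<in> {t-h..t}" for s
  proof -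
    note s0 = pos[OF s]
    define M where "M = (\<Sum>k=1..n. \<rho> ^ (k + 1) * z s k * z s (k + 1))"
    define S where "S = (\<Sum>k=1..n. (\<rho>\<^sup>2 / (p\<^sup>2 * \<mu>)) ^ k * z s k)"
    have "(\<rho> / \<mu>) ^ k * V s k = \<rho> ^ k * (z s (k + 1))\<^sup>2 - 1 / \<mu> * (\<rho> ^ k * z s (k - 1) * z s k)"
      if k: "k \<ge> 1" for k
    proof -
      obtain j where "k = Suc j" using k by (cases k) auto
      then show ?thesis using mu0 by (simp add: V_def power_divide field_simps)
    qed
    then have "(\<Sum>k=1..n. (\<rho> / \<mu>) ^ k * V s k) =
        (\<Sum>k=1..n. \<rho> ^ k * (z s (k + 1))\<^sup>2) - 1 / \<mu> * (\<Sum>k=1..n. \<rho> ^ k * z s (k - 1) * z s k)"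
      by (simp add: sum_subtractf sum_distrib_left)
    also have "(\<Sum>k=1..n. \<rho> ^ k * z s (k - 1) * z s k) =
        (\<Sum>k=1..n. (\<lambda>j. \<rho> ^ (j + 1) * z s j * z s (j + 1)) (k - 1))"
      by (intro sum.cong) auto
    also have "\<dots> = M"
      using sum_shift_down[of "\<lambda>j. \<rho> ^ (j + 1) * z s j * z s (j + 1)" n]
        boundary[OF s0] above[OF s0, of "n + 1"] unfolding M_def by simp
    finally have "\<rho> * (\<Sum>k=1..n. (\<rho> / \<mu>) ^ k * V s k) =
        \<rho> * (\<Sum>k=1..n. \<rho> ^ k * (z s (k + 1))\<^sup>2) - \<rho> / \<mu> * M"
      by (simp add: right_diff_distrib)
    then have LV: "\<rho> * (\<Sum>k=1..n. (\<rho> / \<mu>) ^ k * V s k) =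
        (\<Sum>k=1..n. \<rho> ^ (k + 1) * (z s (k + 1))\<^sup>2) - \<rho> / \<mu> * M"
      by (simp add: sum_distrib_left mult.assoc)
    \<comment> \<open>The gain of mode k involves mode k + 1, so mode 1 is missing from the sum. It
      contributes at most \<rho>, the first summand of C1.\<close>
    have "(\<Sum>k=1..n. \<rho> ^ (k + 1) * (z s (k + 1))\<^sup>2) = wsum r s - \<rho> * (z s 1)\<^sup>2"
      unfolding sum_shift_up[of "\<lambda>k. \<rho> ^ k * (z s k)\<^sup>2"] wsum_def
      using above[OF s0, of "n + 1"]
      by (simp add: \<rho>_def power_mult_distrib flip: power_mult) (simp add: mult.commute)
    moreover have "\<rho> * (z s 1)\<^sup>2 \<le> \<rho> * 1"
      using \<rho> nonneg[OF s0, of 1] le_1[OF s0, of 1] by (intro mult_left_mono power_le_one) auto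
    moreover have "wsum r t \<le> wsum r s"
      using wsum_antimono[of r s t] r s s0 by simp
    ultimately have first: "wsum r t - \<rho> \<le> (\<Sum>k=1..n. \<rho> ^ (k + 1) * (z s (k + 1))\<^sup>2)" by linarith
    have "M \<le> (\<Sum>k=1..n. (p\<^sup>2) ^ k * flux s k + \<rho>\<^sup>2 * ((\<rho>\<^sup>2 / (p\<^sup>2 * \<mu>)) ^ k * z s k))"
      unfolding M_def
    proof (rule sum_mono)
      fix k
      \<comment> \<open>The weight in Young's inequality is chosen so that c z_{k+1}^2 z_k is
        exactly the k-th term of D; what remains is linear in z_k and summable by
        \<open>weighted\<close>.\<close>
      define c where "c = (p\<^sup>2 * \<mu>) ^ k"
      have c: "c > 0" using p mu0 by (simp add: c_def)
      have "\<rho> ^ (k + 1) * (c * z s (k + 1)) \<le> (c * z s (k + 1))\<^sup>2 + (\<rho> ^ (k + 1))\<^sup>2"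
        using sum_squares_bound[of "\<rho> ^ (k + 1)" "c * z s (k + 1)"]
          zero_le_power2[of "\<rho> ^ (k + 1)"] zero_le_power2[of "c * z s (k + 1)"] by linarith
      then have "\<rho> ^ (k + 1) * z s (k + 1) \<le> c * (z s (k + 1))\<^sup>2 + (\<rho> ^ (k + 1))\<^sup>2 / c"
        using c by (simp add: field_simps power2_eq_square)
      from mult_right_mono[OF this nonneg[OF s0, of k]]
      have "\<rho> ^ (k + 1) * z s k * z s (k + 1) \<le> c * (z s (k + 1))\<^sup>2 * z s k + (\<rho> ^ (k + 1))\<^sup>2 / c * z s k"
        by (simp add: algebra_simps)
      also have "c * (z s (k + 1))\<^sup>2 * z s k = (p\<^sup>2) ^ k * flux s k"
        by (simp add: c_def flux_def power_mult_distrib)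
      also have "(\<rho> ^ (k + 1))\<^sup>2 / c * z s k = \<rho>\<^sup>2 * ((\<rho>\<^sup>2 / (p\<^sup>2 * \<mu>)) ^ k * z s k)"
        by (simp add: c_def power_divide power_mult_distrib flip: power_mult) (simp add: mult.commute)
      finally show "\<rho> ^ (k + 1) * z s k * z s (k + 1)
        \<le> (p\<^sup>2) ^ k * flux s k + \<rho>\<^sup>2 * ((\<rho>\<^sup>2 / (p\<^sup>2 * \<mu>)) ^ k * z s k)" .
    qed
    then have M: "M \<le> D s + \<rho>\<^sup>2 * S"
      by (simp add: sum.distrib D_def S_def sum_distrib_left)
    have "\<rho>\<^sup>2 = r ^ 4" "p\<^sup>2 * \<mu> * p = p ^ 3 * \<mu>"
      by (simp_all add: \<rho>_def power2_eq_square power3_eq_cube power4_eq_xxxx)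
    then have "\<rho>\<^sup>2 / (p\<^sup>2 * \<mu>) / p = b" by (simp add: b_def)
    then have "S \<le> C / (1 - b)"
      using weighted[OF s, of "\<rho>\<^sup>2 / (p\<^sup>2 * \<mu>)"] b mu0 by (simp add: S_def)
    then have "\<rho>\<^sup>2 * S \<le> \<rho>\<^sup>2 * (C / (1 - b))" by (intro mult_left_mono) auto
    then have "\<rho> / \<mu> * M \<le> \<rho> / \<mu> * (D s + \<rho>\<^sup>2 * (C / (1 - b)))"
      using M \<rho> mu0 by (intro mult_left_mono) auto
    also have "\<dots> = \<rho> / \<mu> * D s + \<rho> ^ 3 / \<mu> * (C / (1 - b))"
      by (simp add: algebra_simps power2_eq_square power3_eq_cube)
    finally show ?thesis using first unfolding LV C1_def by linarith
  qed
  have "(wsum r t - C1) * (t - (t - h)) \<le> G t - G (t - h)"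
    by (rule deriv_ge_imp_increment_ge[OF G' _ _ lower]) (use h in auto)
  also have "\<dots> \<le> 2 * C2" using G[of t] G[of "t - h"] h by (simp add: abs_le_iff)
  finally have "wsum r t - C1 \<le> 2 * C2 / h" using h by (simp add: field_simps)
  then show ?thesis unfolding C1_def C2_def \<kappa>_def by simp
qed

end

text \<open>C may depend on \<tau>, but not on n, z or t. A positive \<tau> is essential for p > 1,
  because at time 0 the sum equals p^(2n).\<close>

definition smoothing :: "real \<Rightarrow> real \<Rightarrow> bool" where
  "smoothing \<mu> p \<longleftrightarrow> (\<forall>\<tau>>0. \<exists>C. \<forall>n z t. galerkin \<mu> n z \<longrightarrow> \<tau> \<le> t \<longrightarrow>
     (\<Sum>k=1..n. (p ^ k * z t k)\<^sup>2) \<le> C)"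

lemma smoothing_le_1:
  assumes "0 \<le> p" "p \<le> 1" shows "smoothing \<mu> p"
  unfolding smoothing_def
proof (intro allI impI exI[of _ 1])
  fix \<tau> :: real and n z t assume \<tau>: "\<tau> > 0" "\<tau> \<le> t" and "galerkin \<mu> n z"
  then interpret galerkin \<mu> n z by simp
  have "(\<Sum>k=1..n. (p ^ k * z t k)\<^sup>2) \<le> (\<Sum>k=1..n. (z t k)\<^sup>2)"
  proof (rule sum_mono)
    fix k
    have "p ^ k * z t k \<le> 1 * z t k"
      using assms nonneg[of t k] \<tau> by (intro mult_right_mono power_le_one) auto
    then show "(p ^ k * z t k)\<^sup>2 \<le> (z t k)\<^sup>2"
      using assms nonneg[of t k] \<tau> by (intro power_mono) auto
  qed
  also have "\<dots> = 1" using \<tau> by (intro energy) simp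
  finally show "(\<Sum>k=1..n. (p ^ k * z t k)\<^sup>2) \<le> 1" .
qed

lemma smoothing_mono:
  assumes "smoothing \<mu> p" "0 \<le> q" "q \<le> p" shows "smoothing \<mu> q"
  unfolding smoothing_def
proof (intro allI impI)
  fix \<tau> :: real assume \<tau>: "\<tau> > 0"
  then obtain C where C: "\<And>n z t. galerkin \<mu> n z \<Longrightarrow> \<tau> \<le> t \<Longrightarrow> (\<Sum>k=1..n. (p ^ k * z t k)\<^sup>2) \<le> C"
    using assms(1) unfolding smoothing_def by blast
  have "(\<Sum>k=1..n. (q ^ k * z t k)\<^sup>2) \<le> C" if g: "galerkin \<mu> n z" and t: "\<tau> \<le> t" for n z t
  proof (rule order_trans[OF sum_mono C[OF g t]])
    fix k
    have "z t k \<ge> 0" using galerkin.nonneg[OF g] t \<tau> by simp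
    then show "(q ^ k * z t k)\<^sup>2 \<le> (p ^ k * z t k)\<^sup>2"
      using assms by (intro power_mono mult_right_mono) auto
  qed
  then show "\<exists>C. \<forall>n z t. galerkin \<mu> n z \<longrightarrow> \<tau> \<le> t \<longrightarrow> (\<Sum>k=1..n. (q ^ k * z t k)\<^sup>2) \<le> C"
    by blast
qed

lemma smoothing_gain:
  assumes sm: "smoothing \<mu> p" and p: "0 < p" "p < \<mu>" "p \<noteq> 1" and r: "r > 1" "r ^ 4 < p ^ 3 * \<mu>"
  shows "smoothing \<mu> r"
  unfolding smoothing_def
proof (intro allI impI)
  fix \<tau> :: real assume \<tau>: "\<tau> > 0"
  \<comment> \<open>Using the hypothesis from time \<tau>/2 on gives every t >= \<tau> a window of
    length \<tau>/2 behind it, over which \<open>smoothing_step\<close> averages.\<close>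
  then have "\<tau> / 2 > 0" by simp
  then obtain C0 where C0: "\<And>n z t. galerkin \<mu> n z \<Longrightarrow> \<tau>/2 \<le> t \<Longrightarrow> (\<Sum>k=1..n. (p ^ k * z t k)\<^sup>2) \<le> C0"
    using sm unfolding smoothing_def by blast
  define C where "C = max 1 C0"
  show "\<exists>C. \<forall>n z t. galerkin \<mu> n z \<longrightarrow> \<tau> \<le> t \<longrightarrow> (\<Sum>k=1..n. (r ^ k * z t k)\<^sup>2) \<le> C"
  proof (intro exI allI impI)
    fix n z t assume g: "galerkin \<mu> n z" and t: "\<tau> \<le> t"
    interpret galerkin \<mu> n z by fact
    have "wsum p s \<le> C" if "s \<in> {t - \<tau>/2..t}" for s
      using C0[OF g, of s] that t by (auto simp: wsum_def C_def)
    from smoothing_step[OF p r _ _ _ this, of "\<tau> / 2" t]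
    show "(\<Sum>k=1..n. (r ^ k * z t k)\<^sup>2) \<le> r\<^sup>2 + (r\<^sup>2) ^ 3 / \<mu> * (C / (1 - r ^ 4 / (p ^ 3 * \<mu>)))
      + 2 * (r\<^sup>2 * (C / (1 - r\<^sup>2 / (\<mu> * p))) + r\<^sup>2 / \<mu> / (2 * \<bar>1 - p\<^sup>2\<bar>) * C) / (\<tau> / 2)"
      using \<tau> t unfolding wsum_def by (simp add: C_def)
  qed
qed

text \<open>On a logarithmic scale the gain is governed by the affine map taking e to (3 * e + 1) /
  4. Its fixed point e = 1 is the threshold p = \<mu>.\<close>

lemma smoothing_powr_gain:
  assumes mu: "\<mu> > 1" and sm: "smoothing \<mu> (\<mu> powr e)" and e: "e < 1" "e \<noteq> 0"
    and e': "0 < e'" "4 * e' < 3 * e + 1"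
  shows "smoothing \<mu> (\<mu> powr e')"
proof (rule smoothing_gain[OF sm])
  show "\<mu> powr e < \<mu>" using powr_less_mono[OF e(1) mu] mu by simp
  show "\<mu> powr e \<noteq> 1" using mu e by simp
  show "\<mu> powr e' > 1" using mu e' by simp
  have "(\<mu> powr e') ^ 4 = \<mu> powr (4 * e')"
    using mu by (simp add: powr_power mult.commute)
  also have "\<dots> < \<mu> powr (3 * e + 1)" using mu e' by simp
  also have "\<dots> = (\<mu> powr e) ^ 3 * \<mu>"
    using mu by (simp add: powr_add powr_power mult.commute)
  finally show "(\<mu> powr e') ^ 4 < (\<mu> powr e) ^ 3 * \<mu>" .
qed (use mu in auto)

text \<open>In terms of \<open>p = \<mu> powr e\<close>, the distance \<open>d = 1 - e\<close> can be multiplied by any factor above \<open>3/4\<close>.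
  Starting at \<open>d = 6/5\<close> and using the factor \<open>4/5\<close> never hits the excluded case \<open>p = 1\<close>.\<close>

lemma smoothing:
  assumes mu: "\<mu> > 1" and p: "0 \<le> p" "p < \<mu>"
  shows "smoothing \<mu> p"
proof (cases "p = 0")
  case False
  then have p0: "p > 0" using p by simp
  \<comment> \<open>24/25 is 4/5 of 6/5: the first step takes e from -1/5, where the energy alone
    gives the bound, to 1/25 and so jumps over e = 0.\<close>
  have iter: "smoothing \<mu> (\<mu> powr (1 - 24/25 * (4/5) ^ j))" for j
  proof (induction j)
    case 0
    have "smoothing \<mu> (\<mu> powr (- 1/5))"
      by (rule smoothing_le_1) (use mu powr_mono[of "-1/5" 0 \<mu>] in auto)
    then show ?case by (rule smoothing_powr_gain[OF mu]) auto
  next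
    case (Suc j)
    have "0 < (4/5::real) ^ j" "(4/5::real) ^ j \<le> 1" by (auto intro: power_le_one)
    then show ?case by (intro smoothing_powr_gain[OF mu Suc.IH]) auto
  qed
  have "log \<mu> p < 1" using mu p p0 by simp
  then obtain j where j: "(4/5::real) ^ j < 1 - log \<mu> p"
    using real_arch_pow_inv[of "1 - log \<mu> p" "4/5"] by auto
  have "24/25 * (4/5) ^ j \<le> (4/5::real) ^ j" by simp
  then have "log \<mu> p \<le> 1 - 24/25 * (4/5) ^ j" using j by linarith
  then have "\<mu> powr log \<mu> p \<le> \<mu> powr (1 - 24/25 * (4/5) ^ j)" using mu by (intro powr_mono) auto
  then show ?thesis using smoothing_mono[OF iter p(1)] mu p0 by simp
qed (simp add: smoothing_le_1)

section \<open>Bounds that survive the limit\<close>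

context galerkin
begin

lemma partial_energy_le:
  assumes t: "t \<ge> 0" shows "(\<Sum>k=1..m. (z t k)\<^sup>2) \<le> 1"
proof -
  have "(\<Sum>k=1..m. (z t k)\<^sup>2) = (\<Sum>k\<in>{1..m} \<inter> {1..n}. (z t k)\<^sup>2)"
    by (rule sum.mono_neutral_right) (use above[OF t] in auto)
  also have "\<dots> \<le> (\<Sum>k=1..n. (z t k)\<^sup>2)" by (rule sum_mono2) auto
  finally show ?thesis using energy[OF t] by simp
qed

text \<open>A Chebyshev bound: modes above m have weight at least p^(2m), so they carry energy at
  most C / p^(2m). The lower bound concerns finitely many modes and hence passes to componentwise
  limits.\<close>

lemma partial_energy_ge:
  assumes t: "t \<ge> 0" and p: "p \<ge> 1" and C: "(\<Sum>k=1..n. (p ^ k * z t k)\<^sup>2) \<le> C"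
  shows "1 - C / (p ^ m)\<^sup>2 \<le> (\<Sum>k=1..m. (z t k)\<^sup>2)"
proof -
  have "1 \<le> (\<Sum>k=1..n. (if k \<le> m then (z t k)\<^sup>2 else 0) + (p ^ k * z t k)\<^sup>2 / (p ^ m)\<^sup>2)"
    unfolding energy[OF t, symmetric]
  proof (rule sum_mono)
    fix k
    show "(z t k)\<^sup>2 \<le> (if k \<le> m then (z t k)\<^sup>2 else 0) + (p ^ k * z t k)\<^sup>2 / (p ^ m)\<^sup>2"
    proof (cases "k \<le> m")
      case False
      then have "p ^ m * z t k \<le> p ^ k * z t k"
        using p nonneg[OF t] by (intro mult_right_mono power_increasing) auto
      then have "(p ^ m * z t k)\<^sup>2 \<le> (p ^ k * z t k)\<^sup>2"
        using p nonneg[OF t] by (intro power_mono) auto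
      then show ?thesis using False p by (simp add: power_mult_distrib field_simps)
    qed simp
  qed
  also have "\<dots> = (\<Sum>k\<in>{k\<in>{1..n}. k \<le> m}. (z t k)\<^sup>2) + (\<Sum>k=1..n. (p ^ k * z t k)\<^sup>2) / (p ^ m)\<^sup>2"
    unfolding sum.distrib sum_divide_distrib by (subst sum.inter_filter) auto
  also have "\<dots> \<le> (\<Sum>k=1..m. (z t k)\<^sup>2) + C / (p ^ m)\<^sup>2"
    using C by (intro add_mono divide_right_mono sum_mono2) auto
  finally show ?thesis by linarith
qed

text \<open>Both terms lie between 0 and \<mu>^k. The bound is independent of n; it yields
  equicontinuity of each component and the majorant for dominated convergence.\<close>

lemma field_bounds:
  assumes t: "t \<ge> 0"
  shows "\<bar>\<mu> ^ k * (z t (k + 1))\<^sup>2 - \<mu> ^ (k - 1) * z t (k - 1) * z t k\<bar> \<le> \<mu> ^ k"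
proof -
  have z: "0 \<le> z t j * z t i \<and> z t j * z t i \<le> 1" for i j
    using nonneg[OF t] le_1[OF t] by (auto intro: mult_le_one)
  have "0 \<le> \<mu> ^ k * (z t (k + 1) * z t (k + 1))" "\<mu> ^ k * (z t (k + 1) * z t (k + 1)) \<le> \<mu> ^ k * 1"
    using z mu by (auto intro!: mult_left_mono)
  moreover have "0 \<le> \<mu> ^ (k - 1) * (z t (k - 1) * z t k)" "\<mu> ^ (k - 1) * (z t (k - 1) * z t k) \<le> \<mu> ^ k * 1"
    using z[of "k-1" k] mu by (simp, intro mult_mono power_increasing) auto
  ultimately show ?thesis unfolding abs_le_iff power2_eq_square mult.assoc by linarith
qed

lemma lipschitz:
  assumes "s \<ge> 0" "t \<ge> 0" shows "\<bar>z s k - z t k\<bar> \<le> \<mu> ^ k * \<bar>s - t\<bar>"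
proof (cases "k = 0")
  case False
  have "norm (z s k - z t k) \<le> \<mu> ^ k * norm (s - t)"
  proof (rule field_differentiable_bound[where S = "{0..}"])
    show "((\<lambda>u. z u k) has_real_derivative
      \<mu> ^ k * (z u (k + 1))\<^sup>2 - \<mu> ^ (k - 1) * z u (k - 1) * z u k) (at u within {0..})"
      if "u \<in> {0..}" for u using ode[of u k] that False by simp
  qed (use assms field_bounds in auto)
  then show ?thesis by simp
qed (use boundary assms in simp)

end

section \<open>Passage to the limit\<close>

text \<open>A diagonal sequence converges for all components at all rational times; the Lipschitz
  bound, uniform in n, extends convergence to every time.\<close>

lemma equilipschitz_subsequence:
  fixes f :: "nat \<Rightarrow> real \<Rightarrow> nat \<Rightarrow> real"
  assumes bdd: "\<And>n t k. t \<ge> 0 \<Longrightarrow> \<bar>f n t k\<bar> \<le> B"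
    and lip: "\<And>n s t k. s \<ge> 0 \<Longrightarrow> t \<ge> 0 \<Longrightarrow> \<bar>f n s k - f n t k\<bar> \<le> M k * \<bar>s - t\<bar>"
  obtains r g where "strict_mono (r :: nat \<Rightarrow> nat)"
    and "\<And>t k. t \<ge> 0 \<Longrightarrow> (\<lambda>n. f (r n) t k) \<longlonglongrightarrow> g t k"
proof -
  have "countable (UNIV \<times> (\<rat> \<inter> {0..}) :: (nat \<times> real) set)"
    by (intro countable_SIGMA) (auto intro: countable_subset[OF _ countable_rat])
  then obtain r where r: "strict_mono (r :: nat \<Rightarrow> nat)"
    and conv: "\<And>x. x \<in> UNIV \<times> (\<rat> \<inter> {0..}) \<Longrightarrow> \<exists>l. (\<lambda>n. f (r n) (snd x) (fst x)) \<longlonglongrightarrow> l"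
    by (rule function_convergent_subsequence[of _ "\<lambda>n x. f n (snd x) (fst x)" B]) (use bdd in auto)
  have "convergent (\<lambda>n. f (r n) t k)" if t: "t \<ge> 0" for t k
  proof (rule Cauchy_convergent, rule CauchyI)
    fix e :: real assume e: "e > 0"
    define d where "d = e / (3 * (\<bar>M k\<bar> + 1))"
    have d: "d > 0" using e by (simp add: d_def)
    obtain q where q: "q \<in> \<rat>" "t < q" "q < t + d" using Rats_dense_in_real[of t "t + d"] d by auto
    have "\<exists>l. (\<lambda>n. f (r n) q k) \<longlonglongrightarrow> l" using conv[of "(k, q)"] q t by auto
    then have "Cauchy (\<lambda>n. f (r n) q k)" by (metis LIMSEQ_imp_Cauchy)
    then obtain N where N: "\<And>m n. m \<ge> N \<Longrightarrow> n \<ge> N \<Longrightarrow> norm (f (r m) q k - f (r n) q k) < e / 3"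
      using CauchyD[of _ "e/3"] e by (metis divide_pos_pos zero_less_numeral)
    have close: "\<bar>f n t k - f n q k\<bar> \<le> e / 3" for n
    proof -
      have "\<bar>f n t k - f n q k\<bar> \<le> M k * \<bar>t - q\<bar>" using lip[of t q n k] t q by simp
      also have "\<dots> \<le> (\<bar>M k\<bar> + 1) * d" using q by (intro mult_mono) auto
      also have "\<dots> = e / 3" unfolding d_def by (simp add: field_simps)
      finally show ?thesis .
    qed
    have "norm (f (r m) t k - f (r n) t k) < e" if "m \<ge> N" "n \<ge> N" for m n
      using N[OF that] close[of "r m"] close[of "r n"] unfolding real_norm_def by linarith
    then show "\<exists>N. \<forall>m\<ge>N. \<forall>n\<ge>N. norm (f (r m) t k - f (r n) t k) < e" by blast
  qed
  then show thesis
    using r that[of r "\<lambda>t k. lim (\<lambda>n. f (r n) t k)"] by (simp add: convergent_LIMSEQ_iff)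
qed

theorem spontaneous_solution:
  fixes \<mu> :: real
  assumes mu: "\<mu> > 1"
  obtains Z :: "real \<Rightarrow> nat \<Rightarrow> real" where
    "\<And>t k. t \<le> 0 \<Longrightarrow> Z t k = 0" and "\<And>t. Z t 0 = 0" and "\<And>t k. 0 \<le> Z t k"
    and "\<And>t k. k \<ge> 1 \<Longrightarrow> ((\<lambda>u. Z u k) has_real_derivative
      \<mu> ^ k * (Z t (k + 1))\<^sup>2 - \<mu> ^ (k - 1) * Z t (k - 1) * Z t k) (at t)"
    and "\<And>t. t > 0 \<Longrightarrow> (\<lambda>m. \<Sum>k=1..m. (Z t k)\<^sup>2) \<longlonglongrightarrow> 1"
    and "\<And>p \<tau>. 0 \<le> p \<Longrightarrow> p < \<mu> \<Longrightarrow> \<tau> > 0 \<Longrightarrow> \<exists>C. \<forall>t\<ge>\<tau>. \<forall>k\<ge>1. (p ^ k * Z t k)\<^sup>2 \<le> C"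
proof -
  have "\<forall>n. \<exists>z. galerkin \<mu> (Suc n) z"
    using galerkin_exists[OF mu, of "Suc n" for n] by (metis le_add1 plus_1_eq_Suc)
  then obtain z where z: "\<And>n. galerkin \<mu> (Suc n) (z n)" by metis
  obtain r g where r: "strict_mono (r :: nat \<Rightarrow> nat)"
    and lim: "\<And>t k. t \<ge> 0 \<Longrightarrow> (\<lambda>n. z (r n) t k) \<longlonglongrightarrow> g t k"
  proof (rule equilipschitz_subsequence[of z 1 "\<lambda>k. \<mu> ^ k"])
    show "\<bar>z n t k\<bar> \<le> 1" if "t \<ge> 0" for n t k
      using galerkin.nonneg[OF z that, of n k] galerkin.le_1[OF z that, of n k] by simp
    show "\<bar>z n s k - z n t k\<bar> \<le> \<mu> ^ k * \<bar>s - t\<bar>" if "s \<ge> 0" "t \<ge> 0" for n s t k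
      using galerkin.lipschitz[OF z that] .
  qed (blast intro: that)
  have g0: "g 0 k = 0" for k
  proof (rule LIMSEQ_unique[OF lim])
    have "\<forall>\<^sub>F n in sequentially. z (r n) 0 k = 0"
      using eventually_ge_at_top[of k]
    proof eventually_elim
      case (elim n)
      then have "k \<noteq> Suc (r n)" using seq_suble[OF r, of n] by simp
      then show ?case using galerkin.init[OF z, of "r n" k] by simp
    qed
    then show "(\<lambda>n. z (r n) 0 k) \<longlonglongrightarrow> 0" by (rule tendsto_eventually)
  qed simp
  have gnonneg: "0 \<le> g t k" if "t \<ge> 0" for t k
    by (rule tendsto_lowerbound[OF lim[OF that]]) (auto simp: galerkin.nonneg[OF z that])
  have gboundary: "g t 0 = 0" if "t \<ge> 0" for t
    using lim[OF that, of 0] galerkin.boundary[OF z that] by (simp add: LIMSEQ_const_iff)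
  have glip: "\<bar>g s k - g t k\<bar> \<le> \<mu> ^ k * \<bar>s - t\<bar>" if "s \<ge> 0" "t \<ge> 0" for s t k
    by (rule tendsto_upperbound[OF tendsto_rabs[OF tendsto_diff[OF lim lim]]])
      (use that galerkin.lipschitz[OF z that] in auto)
  \<comment> \<open>Since g vanishes at time 0, this extends it by 0 to negative times, and the
    derivatives become two-sided even at 0.\<close>
  define Z where "Z t k = g (max 0 t) k" for t k
  define V where "V y k = \<mu> ^ k * (y (k + 1))\<^sup>2 - \<mu> ^ (k - 1) * y (k - 1) * y k" for y :: "nat \<Rightarrow> real" and k
  have Zneg: "Z t k = 0" if "t \<le> 0" for t k using that g0 by (simp add: Z_def)
  have contZ: "continuous_on S (\<lambda>t. Z t k)" for S k
  proof (rule lipschitz_on_continuous_on[of "\<mu> ^ k"], rule lipschitz_onI)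
    show "dist (Z s k) (Z t k) \<le> \<mu> ^ k * dist s t" for s t
      unfolding Z_def dist_real_def
      by (rule order_trans[OF glip mult_left_mono]) (use mu in auto)
  qed (use mu in simp)
  have contV: "continuous_on S (\<lambda>t. V (Z t) k)" for S k
    unfolding V_def by (intro continuous_intros contZ)
  \<comment> \<open>The limit is taken in the integrated equation, where pointwise convergence
    suffices; differentiability of Z is then recovered from continuity of the integrand.\<close>
  have integral_eq: "Z t k = integral {0..t} (\<lambda>s. V (Z s) k)" if t: "t \<ge> 0" and k: "k \<ge> 1" for t k
  proof -
    have int: "((\<lambda>s. V (z n s) k) has_integral z n t k - z n 0 k) {0..t}" for n
    proof (rule fundamental_theorem_of_calculus[OF t])
      fix s assume "s \<in> {0..t}"
      then have "((\<lambda>u. z n u k) has_real_derivative V (z n s) k) (at s within {0..t})"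
        using DERIV_subset[OF galerkin.ode[OF z _ k, of s n], of "{0..t}"] by (auto simp: V_def)
      then show "((\<lambda>u. z n u k) has_vector_derivative V (z n s) k) (at s within {0..t})"
        by (simp add: has_real_derivative_iff_has_vector_derivative)
    qed
    have "(\<lambda>n. integral {0..t} (\<lambda>s. V (z (r n) s) k)) \<longlonglongrightarrow> integral {0..t} (\<lambda>s. V (Z s) k)"
    proof (rule dominated_convergence(2)[where h = "\<lambda>_. \<mu> ^ k"])
      show "norm (V (z (r n) s) k) \<le> \<mu> ^ k" if "s \<in> {0..t}" for n s
        using galerkin.field_bounds[OF z, of s] that by (simp add: V_def)
      show "(\<lambda>n. V (z (r n) s) k) \<longlonglongrightarrow> V (Z s) k" if "s \<in> {0..t}" for s
        using that unfolding V_def Z_def by (auto intro!: tendsto_intros lim)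
    qed (use int in auto)
    moreover have "integral {0..t} (\<lambda>s. V (z (r n) s) k) = z (r n) t k - z (r n) 0 k" for n
      using int by (rule integral_unique)
    ultimately have "(\<lambda>n. z (r n) t k - z (r n) 0 k) \<longlonglongrightarrow> integral {0..t} (\<lambda>s. V (Z s) k)" by simp
    moreover have "(\<lambda>n. z (r n) t k - z (r n) 0 k) \<longlonglongrightarrow> g t k - g 0 k"
      by (intro tendsto_diff lim) (use t in auto)
    ultimately show ?thesis using LIMSEQ_unique g0 t by (fastforce simp: Z_def)
  qed
  have deriv: "((\<lambda>u. Z u k) has_real_derivative V (Z t) k) (at t)" if k: "k \<ge> 1" for t k
  proof -
    \<comment> \<open>The base point -R makes t an interior point, also when t <= 0. The integrand
      vanishes at negative times, so starting there changes nothing.\<close>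
    define R where "R = \<bar>t\<bar> + 1"
    have R: "-R < t" "t < R" "0 < R" by (auto simp: R_def)
    have zero: "integral {-R..u} (\<lambda>s. V (Z s) k) = 0" if "u \<le> 0" for u
    proof -
      have "integral {-R..u} (\<lambda>s. V (Z s) k) = integral {-R..u} (\<lambda>_. 0)"
        by (rule Henstock_Kurzweil_Integration.integral_cong) (use that in \<open>auto simp: V_def Zneg\<close>)
      then show ?thesis by simp
    qed
    have Zint: "Z u k = integral {-R..u} (\<lambda>s. V (Z s) k)" for u
    proof (cases "u \<le> 0")
      case False
      have "integral {-R..0} (\<lambda>s. V (Z s) k) + integral {0..u} (\<lambda>s. V (Z s) k)
          = integral {-R..u} (\<lambda>s. V (Z s) k)"
        by (rule Henstock_Kurzweil_Integration.integral_combine)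
          (use False R contV in \<open>auto intro!: integrable_continuous_real\<close>)
      then show ?thesis using zero[of 0] integral_eq[OF _ k, of u] False by simp
    qed (use zero Zneg in simp)
    have "((\<lambda>u. integral {-R..u} (\<lambda>s. V (Z s) k)) has_real_derivative V (Z t) k) (at t within {-R..R})"
      by (rule integral_has_real_derivative[OF contV]) (use R in auto)
    then show ?thesis
      using R by (simp add: Zint[symmetric] at_within_Icc_at)
  qed
  have energy: "(\<lambda>m. \<Sum>k=1..m. (Z t k)\<^sup>2) \<longlonglongrightarrow> 1" if t: "t > 0" for t
  proof -
    \<comment> \<open>Any p strictly between 1 and \<mu> serves: p > 1 makes the tail small, p <
      \<mu> gives the uniform bound.\<close>
    define p where "p = (1 + \<mu>) / 2"
    have p: "1 < p" "p < \<mu>" using mu by (auto simp: p_def)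
    have "smoothing \<mu> p" using p by (intro smoothing[OF mu]) auto
    then obtain C where "\<And>n z t'. galerkin \<mu> n z \<Longrightarrow> t \<le> t' \<Longrightarrow> (\<Sum>k=1..n. (p ^ k * z t' k)\<^sup>2) \<le> C"
      using t unfolding smoothing_def by blast
    then have C: "(\<Sum>k=1..Suc n. (p ^ k * z n t k)\<^sup>2) \<le> C" for n using z by blast
    have conv: "(\<lambda>n. \<Sum>k=1..m. (z (r n) t k)\<^sup>2) \<longlonglongrightarrow> (\<Sum>k=1..m. (Z t k)\<^sup>2)" for m
      unfolding Z_def using t by (intro tendsto_intros) (auto intro: lim)
    have le: "(\<Sum>k=1..m. (Z t k)\<^sup>2) \<le> 1" for m
      by (rule tendsto_upperbound[OF conv])
        (use t galerkin.partial_energy_le[OF z, of t] in auto)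
    have ge: "1 - C * (1 / p\<^sup>2) ^ m \<le> (\<Sum>k=1..m. (Z t k)\<^sup>2)" for m
    proof -
      have "1 - C / (p ^ m)\<^sup>2 \<le> (\<Sum>k=1..m. (Z t k)\<^sup>2)"
      proof (rule tendsto_lowerbound[OF conv])
        have "1 - C / (p ^ m)\<^sup>2 \<le> (\<Sum>k=1..m. (z n t k)\<^sup>2)" for n
          by (rule galerkin.partial_energy_ge[OF z[of n] _ _ C[of n]]) (use t p in auto)
        then show "\<forall>\<^sub>F n in sequentially. 1 - C / (p ^ m)\<^sup>2 \<le> (\<Sum>k=1..m. (z (r n) t k)\<^sup>2)"
          by simp
      qed simp
      then show ?thesis by (simp add: power_divide flip: power_mult) (simp add: mult.commute)
    qed
    have "(\<lambda>m. 1 - C * (1 / p\<^sup>2) ^ m) \<longlonglongrightarrow> 1 - C * 0"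
      using p by (intro tendsto_intros LIMSEQ_power_zero) auto
    then have lower: "(\<lambda>m. 1 - C * (1 / p\<^sup>2) ^ m) \<longlonglongrightarrow> 1" by simp
    show ?thesis
      by (rule tendsto_sandwich[OF always_eventually always_eventually lower tendsto_const])
        (simp_all only: le ge simp_thms)
  qed
  \<comment> \<open>Each single mode inherits the bound in the limit. This is enough, since raising
    p slightly restores summability.\<close>
  have bound: "\<exists>C. \<forall>t\<ge>\<tau>. \<forall>k\<ge>1. (p ^ k * Z t k)\<^sup>2 \<le> C" if p: "0 \<le> p" "p < \<mu>" and \<tau>: "\<tau> > 0" for p \<tau>
  proof -
    obtain C where "\<And>n z t. galerkin \<mu> n z \<Longrightarrow> \<tau> \<le> t \<Longrightarrow> (\<Sum>k=1..n. (p ^ k * z t k)\<^sup>2) \<le> C"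
      using smoothing[OF mu p] \<tau> unfolding smoothing_def by blast
    then have C: "(\<Sum>k=1..Suc n. (p ^ k * z n t k)\<^sup>2) \<le> C" if "\<tau> \<le> t" for n t using z that by blast
    have "(p ^ k * Z t k)\<^sup>2 \<le> C" if t: "t \<ge> \<tau>" and k: "k \<ge> 1" for t k
    proof (rule tendsto_upperbound)
      show "(\<lambda>n. (p ^ k * z (r n) t k)\<^sup>2) \<longlonglongrightarrow> (p ^ k * Z t k)\<^sup>2"
        unfolding Z_def using t \<tau> by (auto intro!: tendsto_intros lim)
      show "\<forall>\<^sub>F n in sequentially. (p ^ k * z (r n) t k)\<^sup>2 \<le> C"
        using eventually_ge_at_top[of k]
      proof eventually_elim
        case (elim n)
        then have "k \<in> {1..Suc (r n)}" using seq_suble[OF r, of n] k by simp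
        then have "(p ^ k * z (r n) t k)\<^sup>2 \<le> (\<Sum>k=1..Suc (r n). (p ^ k * z (r n) t k)\<^sup>2)"
          by (intro member_le_sum) auto
        then show ?case using C[OF t, of "r n"] by linarith
      qed
    qed simp
    then show ?thesis by blast
  qed
  show thesis
  proof (rule that[of Z])
    show "Z t 0 = 0" "0 \<le> Z t k" for t k by (auto simp: Z_def gboundary gnonneg)
  qed (use Zneg deriv energy bound in \<open>auto simp: V_def\<close>)
qed

section \<open>Norms, continuity and blow-up\<close>

lemma nonneg_has_sum_from_1:
  fixes f :: "nat \<Rightarrow> real"
  assumes "(\<lambda>k. f (Suc k)) sums x" "\<And>k. f k \<ge> 0"
  shows "(f has_sum x) {1..}"
proof -
  have "((\<lambda>k. f (Suc k)) has_sum x) UNIV"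
    using assms by (intro sums_nonneg_imp_has_sum)
  moreover have "bij_betw Suc UNIV {1..}"
    by (rule bij_betwI[where g = "\<lambda>n. n - 1"]) auto
  ultimately show ?thesis using has_sum_reindex_bij_betw by blast
qed

lemma shell_powr: "lam > 0 \<Longrightarrow> shell lam k powr a = (lam powr a) ^ k"
  unfolding shell_def by (induction k) (auto simp: powr_mult)

text \<open>The strictly larger weight q leaves a geometric factor with ratio below 1, so bounds on
  individual modes suffice.\<close>

lemma Hs_summable:
  assumes lam: "lam > 0" and q: "lam powr (2 * s) < q" and C: "\<And>k. k \<ge> 1 \<Longrightarrow> q ^ k * (y k)\<^sup>2 \<le> C"
  shows "summable (\<lambda>k. (lam powr (2 * s)) ^ Suc k * (y (Suc k))\<^sup>2)"
    and "y \<in> Hs_space lam s" and "Hs_norm lam s y = sqrt (\<Sum>k. (lam powr (2 * s)) ^ Suc k * (y (Suc k))\<^sup>2)"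
proof -
  let ?f = "\<lambda>k. (lam powr (2 * s)) ^ Suc k * (y (Suc k))\<^sup>2"
  define w where "w = lam powr (2 * s)"
  have w: "0 < w" "w < q" using lam q by (auto simp: w_def)
  show sum: "summable ?f"
  proof (rule summable_comparison_test')
    show "summable (\<lambda>k. C * (w / q) ^ Suc k)"
      using w by (intro summable_mult) (simp add: summable_geometric)
    fix k :: nat
    have "w ^ Suc k * (y (Suc k))\<^sup>2 = (w / q) ^ Suc k * (q ^ Suc k * (y (Suc k))\<^sup>2)"
      using w by (simp add: power_divide)
    also have "\<dots> \<le> (w / q) ^ Suc k * C" using w by (intro mult_left_mono C) auto
    finally show "norm ((lam powr (2 * s)) ^ Suc k * (y (Suc k))\<^sup>2) \<le> C * (w / q) ^ Suc k"
      using w by (simp add: w_def mult.commute)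
  qed
  have "((\<lambda>k. (lam powr (2 * s)) ^ k * (y k)\<^sup>2) has_sum (\<Sum>k. ?f k)) {1..}"
    by (rule nonneg_has_sum_from_1[OF summable_sums[OF sum]]) (use lam in auto)
  then have "((\<lambda>k. shell lam k powr (2 * s) * (y k)\<^sup>2) has_sum (\<Sum>k. ?f k)) {1..}"
    using lam by (simp add: shell_powr)
  then show "y \<in> Hs_space lam s" "Hs_norm lam s y = sqrt (\<Sum>k. ?f k)"
    by (auto simp: Hs_space_def Hs_norm_def infsumI summable_on_def)
qed

text \<open>Dominated convergence for series (Tannery): continuity of components together with a
  geometric majorant valid near t. Both q and C may vary with t.\<close>

lemma continuous_HsI:
  assumes lam: "lam > 0"
    and cont: "\<And>k. continuous_on I (\<lambda>t. Y t k)"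
    and bound: "\<And>t. t \<in> I \<Longrightarrow> \<exists>q C. lam powr (2 * s) < q \<and> (\<forall>k\<ge>1. q ^ k * (Y t k)\<^sup>2 \<le> C) \<and>
      (\<forall>\<^sub>F u in at t within I. \<forall>k\<ge>1. q ^ k * (Y u k)\<^sup>2 \<le> C)"
  shows "continuous_Hs lam s I Y"
  unfolding continuous_Hs_def
proof (intro conjI ballI)
  fix t assume t: "t \<in> I"
  obtain q C where q: "lam powr (2 * s) < q" and C: "\<And>k. k \<ge> 1 \<Longrightarrow> q ^ k * (Y t k)\<^sup>2 \<le> C"
    and ev: "\<forall>\<^sub>F u in at t within I. \<forall>k\<ge>1. q ^ k * (Y u k)\<^sup>2 \<le> C"
    using bound[OF t] by blast
  show "Y t \<in> Hs_space lam s" by (rule Hs_summable(2)[OF lam q C])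
  define w where "w = lam powr (2 * s)"
  have w: "0 < w" "w < q" using lam q by (auto simp: w_def)
  have diff: "q ^ k * (Y u k - Y t k)\<^sup>2 \<le> 4 * C" if "\<forall>k\<ge>1. q ^ k * (Y u k)\<^sup>2 \<le> C" "k \<ge> 1" for u k
  proof -
    have "(Y u k - Y t k)\<^sup>2 \<le> 2 * (Y u k)\<^sup>2 + 2 * (Y t k)\<^sup>2"
      using zero_le_power2[of "Y u k + Y t k"] by (simp add: power2_sum power2_diff)
    then have "q ^ k * (Y u k - Y t k)\<^sup>2 \<le> q ^ k * (2 * (Y u k)\<^sup>2 + 2 * (Y t k)\<^sup>2)"
      using w by (intro mult_left_mono) auto
    also have "\<dots> = 2 * (q ^ k * (Y u k)\<^sup>2) + 2 * (q ^ k * (Y t k)\<^sup>2)" by (simp add: algebra_simps)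
    finally show ?thesis using that C[OF that(2)] by (smt (verit))
  qed
  let ?a = "\<lambda>k u. w ^ Suc k * (Y u (Suc k) - Y t (Suc k))\<^sup>2"
  show "((\<lambda>u. Hs_norm lam s (\<lambda>k. Y u k - Y t k)) \<longlongrightarrow> 0) (at t within I)"
  proof (cases "at t within I = bot")
    case False
    have "((\<lambda>u. \<Sum>k. ?a k u) \<longlongrightarrow> (\<Sum>k. 0)) (at t within I)"
    proof (rule tannerys_theorem[THEN conjunct2, THEN conjunct2])
      show "((\<lambda>u. ?a k u) \<longlongrightarrow> 0) (at t within I)" for k
      proof -
        have "((\<lambda>u. Y u (Suc k)) \<longlongrightarrow> Y t (Suc k)) (at t within I)"
          using cont[of "Suc k"] t by (simp add: continuous_on_def)
        then have "((\<lambda>u. ?a k u) \<longlongrightarrow> w ^ Suc k * (Y t (Suc k) - Y t (Suc k))\<^sup>2) (at t within I)"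
          by (intro tendsto_intros)
        then show ?thesis by simp
      qed
      have "\<forall>\<^sub>F u in at t within I. \<forall>k. norm (?a k u) \<le> 4 * C * (w / q) ^ Suc k"
        using ev
      proof eventually_elim
        case (elim u)
        show ?case
        proof
          fix k
          have "?a k u = (w / q) ^ Suc k * (q ^ Suc k * (Y u (Suc k) - Y t (Suc k))\<^sup>2)"
            using w by (simp add: power_divide)
          also have "\<dots> \<le> (w / q) ^ Suc k * (4 * C)"
            using w diff[OF elim, of "Suc k"] by (intro mult_left_mono) auto
          finally show "norm (?a k u) \<le> 4 * C * (w / q) ^ Suc k"
            using w by (simp add: mult.commute)
        qed
      qed
      then show "\<forall>\<^sub>F (k, u) in sequentially \<times>\<^sub>F (at t within I). norm (?a k u) \<le> 4 * C * (w / q) ^ Suc k"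
        unfolding eventually_prod_filter by (intro exI[of _ "\<lambda>_. True"] exI conjI) auto
      show "summable (\<lambda>k. 4 * C * (w / q) ^ Suc k)"
        using w by (intro summable_mult) (simp add: summable_geometric)
    qed (use False in auto)
    then have "((\<lambda>u. sqrt (\<Sum>k. ?a k u)) \<longlongrightarrow> sqrt 0) (at t within I)"
      by (intro tendsto_real_sqrt) simp
    moreover have "\<forall>\<^sub>F u in at t within I. sqrt (\<Sum>k. ?a k u) = Hs_norm lam s (\<lambda>k. Y u k - Y t k)"
      using ev
    proof eventually_elim
      case (elim u)
      show ?case
        using Hs_summable(3)[OF lam q diff[OF elim]] by (simp add: w_def)
    qed
    ultimately show ?thesis by (simp add: tendsto_cong)
  qed simp
qed

section \<open>Blow-up rate and assembly\<close>

lemma power_bracket: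
  fixes b x :: real
  assumes "b > 1" "x \<ge> 1"
  obtains m where "b ^ m \<le> x" "x < b ^ Suc m"
proof -
  define n where "n = (LEAST n. x < b ^ n)"
  have n: "x < b ^ n" unfolding n_def using real_arch_pow[OF assms(1), of x] by (metis LeastI)
  then obtain m where m: "n = Suc m" using assms(2) by (cases n) auto
  then have "\<not> x < b ^ m" unfolding n_def by (metis lessI not_less_Least)
  then show thesis using that[of m] n m by simp
qed

text \<open>Transfers among the modes up to m cancel; only the flux from mode m + 1 into mode m
  remains, and it is at most \<mu>^m because all modes lie in [0, 1].\<close>

lemma low_mode_energy_le:
  fixes Z :: "real \<Rightarrow> nat \<Rightarrow> real"
  assumes mu: "\<mu> > 0" and zero: "\<And>k. Z 0 k = 0" and Z0: "\<And>t. Z t 0 = 0"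
    and Z: "\<And>t k. 0 \<le> Z t k" "\<And>t k. Z t k \<le> 1"
    and ode: "\<And>t k. k \<ge> 1 \<Longrightarrow> ((\<lambda>u. Z u k) has_real_derivative
      \<mu> ^ k * (Z t (k + 1))\<^sup>2 - \<mu> ^ (k - 1) * Z t (k - 1) * Z t k) (at t)"
    and t: "t \<ge> 0"
  shows "(\<Sum>k=1..m. (Z t k)\<^sup>2) \<le> 2 * \<mu> ^ m * t"
proof -
  define g where "g t k = \<mu> ^ k * Z t k * (Z t (k + 1))\<^sup>2" for t k
  have der: "((\<lambda>u. - (\<Sum>k=1..m. (Z u k)\<^sup>2)) has_real_derivative - (2 * g t m)) (at t)" for t
  proof -
    have "((\<lambda>u. \<Sum>k=1..m. (Z u k)\<^sup>2) has_real_derivative (\<Sum>k=1..m. 2 * Z t k *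
      (\<mu> ^ k * (Z t (k + 1))\<^sup>2 - \<mu> ^ (k - 1) * Z t (k - 1) * Z t k))) (at t)"
      by (intro DERIV_sum) (auto intro!: derivative_eq_intros ode)
    also have "(\<Sum>k=1..m. 2 * Z t k * (\<mu> ^ k * (Z t (k + 1))\<^sup>2 - \<mu> ^ (k - 1) * Z t (k - 1) * Z t k))
      = 2 * (\<Sum>k=1..m. 1 ^ k * (g t k - g t (k - 1)))"
      unfolding sum_distrib_left
      by (intro sum.cong) (auto simp: g_def power2_eq_square algebra_simps)
    also have "\<dots> = 2 * g t m"
      unfolding weighted_telescope by (simp add: g_def Z0)
    finally show ?thesis by (rule DERIV_minus)
  qed
  have "- (2 * \<mu> ^ m) * (t - 0) \<le> - (\<Sum>k=1..m. (Z t k)\<^sup>2) - - (\<Sum>k=1..m. (Z 0 k)\<^sup>2)"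
  proof (rule deriv_ge_imp_increment_ge[OF der])
    fix u
    have "g u m \<le> \<mu> ^ m * 1 * 1"
      unfolding g_def using mu Z by (intro mult_mono power_le_one) auto
    then show "- (2 * \<mu> ^ m) \<le> - (2 * g u m)" by simp
  qed (use t in auto)
  then show ?thesis by (simp add: zero)
qed

theorem corollary1p8:
  fixes \<alpha> lam T :: real
  assumes "\<alpha> > 0" and "lam > 1" and "T > 0"
  shows "\<exists>Y :: real \<Rightarrow> nat \<Rightarrow> real.
    dyadic_solution \<alpha> lam Y \<and>
    (\<forall>k\<ge>1. \<forall>t\<ge>0. Y t k \<le> 0) \<and>
    (\<forall>k\<ge>1. C1_within {0..} (\<lambda>t. Y t k)) \<and>
    (\<forall>t\<ge>T. \<forall>k\<ge>1. Y t k = 0) \<and>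
    (\<forall>t. 0 \<le> t \<and> t < T \<longrightarrow> Y t \<in> Hs_space lam 0 \<and> Hs_norm lam 0 (Y t) = 1) \<and>
    (\<forall>s<\<alpha>. continuous_Hs lam s {0..<T} Y) \<and>
    (\<forall>s<0. continuous_Hs lam s {0..} Y) \<and>
    (\<forall>r. 0 < r \<and> r < \<alpha> \<longrightarrow>
       (\<exists>c \<delta>. c > 0 \<and> 0 < \<delta> \<and> \<delta> \<le> T \<and>
          (\<forall>t. T - \<delta> < t \<and> t < T \<longrightarrow>
             Hs_norm lam r (Y t) \<ge> c * (T - t) powr (- r / \<alpha>))))"
proof -
  define \<mu> where "\<mu> = lam powr \<alpha>"
  have lam: "lam > 0" using assms by simp
  have mu: "\<mu> > 1" using assms by (simp add: \<mu>_def)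
  obtain Z :: "real \<Rightarrow> nat \<Rightarrow> real" where
    Zneg: "\<And>t k. t \<le> 0 \<Longrightarrow> Z t k = 0" and Z0: "\<And>t. Z t 0 = 0" and Znonneg: "\<And>t k. 0 \<le> Z t k"
    and ode: "\<And>t k. k \<ge> 1 \<Longrightarrow> ((\<lambda>u. Z u k) has_real_derivative
      \<mu> ^ k * (Z t (k + 1))\<^sup>2 - \<mu> ^ (k - 1) * Z t (k - 1) * Z t k) (at t)"
    and energy: "\<And>t. t > 0 \<Longrightarrow> (\<lambda>m. \<Sum>k=1..m. (Z t k)\<^sup>2) \<longlonglongrightarrow> 1"
    and bound: "\<And>p \<tau>. 0 \<le> p \<Longrightarrow> p < \<mu> \<Longrightarrow> \<tau> > 0 \<Longrightarrow> \<exists>C. \<forall>t\<ge>\<tau>. \<forall>k\<ge>1. (p ^ k * Z t k)\<^sup>2 \<le> C"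
    using spontaneous_solution[OF mu] by blast
  define Y where "Y t k = - Z (T - t) k" for t k
  define V where "V t k = \<mu> ^ k * (Y t (k + 1))\<^sup>2 - \<mu> ^ (k - 1) * Y t (k - 1) * Y t k" for t k
  have Zcont: "continuous_on S (\<lambda>t. Z t k)" for S k
  proof (cases "k = 0")
    case False
    then have "isCont (\<lambda>t. Z t k) t" for t using DERIV_isCont[OF ode[of k t]] by simp
    then show ?thesis by (simp add: continuous_at_imp_continuous_on)
  qed (simp add: Z0)
  have Ycont: "continuous_on S (\<lambda>t. Y t k)" for S k
    unfolding Y_def by (intro continuous_intros continuous_on_compose2[OF Zcont[of UNIV]]) auto
  have Yode: "((\<lambda>t. Y t k) has_real_derivative V t k) (at t within S)" if "k \<ge> 1" for k t S
  proof -
    have "((\<lambda>t. Z (T - t) k) has_real_derivative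
      (\<mu> ^ k * (Z (T - t) (k + 1))\<^sup>2 - \<mu> ^ (k - 1) * Z (T - t) (k - 1) * Z (T - t) k) * (- 1)) (at t)"
      by (rule DERIV_chain2[OF ode[OF that]]) (auto intro!: derivative_eq_intros)
    then have "((\<lambda>t. Y t k) has_real_derivative V t k) (at t)"
      unfolding Y_def V_def by (auto dest: DERIV_minus)
    then show ?thesis by (rule has_field_derivative_at_within)
  qed
  have Z1: "Z t k \<le> 1" for t k
  proof (cases "t > 0 \<and> k \<ge> 1")
    case True
    have "(Z t k)\<^sup>2 \<le> 1"
    proof (rule tendsto_lowerbound[OF energy])
      show "\<forall>\<^sub>F m in sequentially. (Z t k)\<^sup>2 \<le> (\<Sum>k=1..m. (Z t k)\<^sup>2)"
        using eventually_ge_at_top[of k]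
        by eventually_elim (use True in \<open>auto intro!: member_le_sum\<close>)
    qed (use True in auto)
    then show ?thesis using power2_le_imp_le[of "Z t k" 1] by simp
  qed (use Zneg Z0 in \<open>auto simp: not_less not_le\<close>)
  have Ysq: "(Y t k)\<^sup>2 = (Z (T - t) k)\<^sup>2" for t k by (simp add: Y_def)
  have low: "(\<Sum>k=1..m. (Z t k)\<^sup>2) \<le> 2 * \<mu> ^ m * t" if "t \<ge> 0" for m t
    by (rule low_mode_energy_le[OF _ _ Z0 Znonneg Z1 ode that]) (use mu Zneg in auto)

  have solution: "dyadic_solution \<alpha> lam Y"
    unfolding dyadic_solution_def using Yode lam
    by (auto simp: shell_powr V_def \<mu>_def) (simp add: Y_def Z0)
  have C1: "C1_within {0..} (\<lambda>t. Y t k)" if "k \<ge> 1" for k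
    unfolding C1_within_def
    by (rule exI[of _ "\<lambda>t. V t k"])
      (use Yode[OF that] in \<open>auto intro!: continuous_intros Ycont simp: V_def\<close>)
  have norm1: "Y t \<in> Hs_space lam 0 \<and> Hs_norm lam 0 (Y t) = 1" if "t < T" for t
  proof -
    have "(\<lambda>k. (Y t (Suc k))\<^sup>2) sums 1"
      using energy[of "T - t"] that
      by (simp add: sums_def Ysq sum.atLeast1_atMost_eq)
    then have "((\<lambda>k. (Y t k)\<^sup>2) has_sum 1) {1..}" by (rule nonneg_has_sum_from_1) simp
    then have "((\<lambda>k. shell lam k powr (2 * 0) * (Y t k)\<^sup>2) has_sum 1) {1..}"
      using lam by (simp add: shell_def)
    then show ?thesis by (auto simp: Hs_space_def Hs_norm_def infsumI summable_on_def)
  qed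
  have weighted: "\<exists>q C. lam powr (2 * s) < q \<and> (\<forall>t\<ge>\<tau>. \<forall>k\<ge>1. q ^ k * (Z t k)\<^sup>2 \<le> C)"
    if s: "s < \<alpha>" and \<tau>: "\<tau> > 0" for s \<tau>
  proof -
    \<comment> \<open>Some base between \<open>lam powr s\<close> and \<mu> exists because s <
      \<alpha>; the gap below p is the room that \<open>Hs_summable\<close> asks for.\<close>
    define p where "p = (lam powr s + \<mu>) / 2"
    have "lam powr s < \<mu>" unfolding \<mu>_def using assms s by simp
    then have p: "lam powr s < p" "p < \<mu>" by (auto simp: p_def)
    have p0: "p > 0" using p(1) powr_ge_zero[of lam s] by linarith
    have "lam powr (2 * s) = (lam powr s)\<^sup>2" unfolding mult_2 powr_add power2_eq_square ..
    also have "\<dots> < p\<^sup>2" using p by (intro power_strict_mono) auto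
    finally have q: "lam powr (2 * s) < p\<^sup>2" .
    obtain C where "\<forall>t\<ge>\<tau>. \<forall>k\<ge>1. (p ^ k * Z t k)\<^sup>2 \<le> C" using bound[of p \<tau>] p p0 \<tau> by auto
    then have "\<forall>t\<ge>\<tau>. \<forall>k\<ge>1. (p\<^sup>2) ^ k * (Z t k)\<^sup>2 \<le> C"
      by (simp add: power_mult_distrib power_even_eq mult.commute flip: power_mult)
    then show ?thesis using q by blast
  qed
  have cont_pre: "continuous_Hs lam s {0..<T} Y" if s: "s < \<alpha>" for s
  proof (rule continuous_HsI[OF lam Ycont])
    fix t assume t: "t \<in> {0..<T}"
    \<comment> \<open>Half of the remaining time, so that the bound valid for T - u >= \<tau> also
      covers times u slightly later than t.\<close>
    define \<tau> where "\<tau> = (T - t) / 2"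
    have \<tau>: "\<tau> > 0" "T - t \<ge> \<tau>" using t by (auto simp: \<tau>_def)
    obtain q C where q: "lam powr (2 * s) < q" and C: "\<And>t k. t \<ge> \<tau> \<Longrightarrow> k \<ge> 1 \<Longrightarrow> q ^ k * (Z t k)\<^sup>2 \<le> C"
      using weighted[OF s \<tau>(1)] by blast
    have "\<forall>\<^sub>F u in at t within {0..<T}. u < T - \<tau>"
      by (rule order_tendstoD[OF tendsto_ident_at]) (use t in \<open>auto simp: \<tau>_def field_simps\<close>)
    then have "\<forall>\<^sub>F u in at t within {0..<T}. \<forall>k\<ge>1. q ^ k * (Y u k)\<^sup>2 \<le> C"
      by eventually_elim (auto simp: Ysq intro!: C)
    then show "\<exists>q C. lam powr (2 * s) < q \<and> (\<forall>k\<ge>1. q ^ k * (Y t k)\<^sup>2 \<le> C) \<and>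
      (\<forall>\<^sub>F u in at t within {0..<T}. \<forall>k\<ge>1. q ^ k * (Y u k)\<^sup>2 \<le> C)"
      using q C \<tau>(2) by (auto simp: Ysq)
  qed
  \<comment> \<open>For s < 0 the bound by 1 on each mode is enough, with q = 1. It holds at all
    times, and so continuity extends across T.\<close>
  have cont_all: "continuous_Hs lam s {0..} Y" if s: "s < 0" for s
  proof (rule continuous_HsI[OF lam Ycont])
    have "lam powr (2 * s) < 1" using assms s by (simp add: powr_less_one)
    moreover have "(Y u k)\<^sup>2 \<le> 1" for u k
      unfolding Ysq using Znonneg Z1 by (intro power_le_one)
    ultimately show "\<exists>q C. lam powr (2 * s) < q \<and> (\<forall>k\<ge>1. q ^ k * (Y t k)\<^sup>2 \<le> C) \<and>
      (\<forall>\<^sub>F u in at t within {0..}. \<forall>k\<ge>1. q ^ k * (Y u k)\<^sup>2 \<le> C)" for t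
      by (intro exI[of _ 1]) auto
  qed
  have blowup: "\<exists>c \<delta>. c > 0 \<and> 0 < \<delta> \<and> \<delta> \<le> T \<and>
      (\<forall>t. T - \<delta> < t \<and> t < T \<longrightarrow> Hs_norm lam r (Y t) \<ge> c * (T - t) powr (- r / \<alpha>))"
    if r: "0 < r" "r < \<alpha>" for r
  proof (intro exI conjI allI impI)
    \<comment> \<open>The root of 1/2 stems from the half of the energy above mode m, the power of 4
      from the threshold 1 / (4 * x) that selects m.\<close>
    define c where "c = sqrt (1/2) * 4 powr (- r / \<alpha>)"
    show "c > 0" by (simp add: c_def)
    \<comment> \<open>Below 1/4 the threshold 1 / (4 * x) exceeds 1, as \<open>power_bracket\<close>
      requires.\<close>
    show "0 < min T (1/4)" "min T (1/4) \<le> T" using assms by auto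
    fix t assume "T - min T (1/4) < t \<and> t < T"
    then have x: "0 < T - t" "T - t < 1/4" by auto
    define x where "x = T - t"
    define w where "w = lam powr (2 * r)"
    have w1: "w \<ge> 1" unfolding w_def using assms r by (intro ge_one_powr_ge_zero) auto
    define S where "S = (\<Sum>\<^sub>\<infinity>k\<in>{1..}. shell lam k powr (2 * r) * (Y t k)\<^sup>2)"
    have "Y t \<in> Hs_space lam r"
    proof -
      obtain q C where "lam powr (2 * r) < q" "\<forall>t\<ge>x. \<forall>k\<ge>1. q ^ k * (Z t k)\<^sup>2 \<le> C"
        using weighted[OF r(2), of x] x by (auto simp: x_def)
      then show ?thesis by (intro Hs_summable(2)[OF lam, of r q _ C]) (auto simp: Ysq x_def)
    qed
    then have summ: "(\<lambda>k. shell lam k powr (2 * r) * (Y t k)\<^sup>2) summable_on {1..}"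
      by (simp add: Hs_space_def)
    have partial: "(\<Sum>k=1..N. w ^ k * (Z x k)\<^sup>2) \<le> S" for N
    proof -
      have "(\<Sum>k=1..N. shell lam k powr (2 * r) * (Y t k)\<^sup>2) \<le> S"
        unfolding S_def by (rule finite_sum_le_infsum[OF summ]) auto
      then show ?thesis using lam by (simp add: shell_powr w_def Ysq x_def)
    qed
    \<comment> \<open>The last m for which the bound 2 * \<mu>^m * x on the low-mode energy is at
      most 1/2. Its maximality, the second inequality, yields the rate.\<close>
    obtain m where m: "\<mu> ^ m \<le> 1 / (4 * x)" "1 / (4 * x) < \<mu> ^ Suc m"
      using power_bracket[OF mu, of "1 / (4 * x)"] x by (auto simp: x_def field_simps)
    have "2 * \<mu> ^ m * x \<le> 1/2" using m(1) x by (simp add: x_def field_simps)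
    then have lowm: "(\<Sum>k=1..m. (Z x k)\<^sup>2) \<le> 1/2" using low[of x m] x by (simp add: x_def)
    \<comment> \<open>Modes above m have weight at least w^(m+1), and the others are compensated by
      the last term. Letting N grow replaces the partial energy by 1.\<close>
    have "w ^ Suc m * (\<Sum>k=1..N. (Z x k)\<^sup>2) \<le> S + w ^ Suc m * (1/2)" for N
    proof -
      have "w ^ Suc m * (\<Sum>k=1..N. (Z x k)\<^sup>2) \<le>
        (\<Sum>k=1..N. w ^ k * (Z x k)\<^sup>2 + w ^ Suc m * (if k \<le> m then (Z x k)\<^sup>2 else 0))"
        unfolding sum_distrib_left
      proof (rule sum_mono)
        fix k
        show "w ^ Suc m * (Z x k)\<^sup>2 \<le> w ^ k * (Z x k)\<^sup>2 + w ^ Suc m * (if k \<le> m then (Z x k)\<^sup>2 else 0)"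
        proof (cases "k \<le> m")
          case False
          then have "w ^ Suc m \<le> w ^ k" using w1 by (intro power_increasing) auto
          then show ?thesis using False by (auto intro!: mult_right_mono)
        qed (use w1 in simp)
      qed
      also have "\<dots> = (\<Sum>k=1..N. w ^ k * (Z x k)\<^sup>2) + w ^ Suc m * (\<Sum>k\<in>{k\<in>{1..N}. k \<le> m}. (Z x k)\<^sup>2)"
        unfolding sum.distrib sum_distrib_left[symmetric] by (subst sum.inter_filter) auto
      also have "(\<Sum>k\<in>{k\<in>{1..N}. k \<le> m}. (Z x k)\<^sup>2) \<le> (\<Sum>k=1..m. (Z x k)\<^sup>2)"
        by (rule sum_mono2) auto
      finally show ?thesis using partial[of N] lowm w1
        by (smt (verit, best) mult_left_mono zero_le_power)
    qed
    then have "w ^ Suc m * 1 \<le> S + w ^ Suc m * (1/2)"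
      using energy[of x] x by (intro tendsto_upperbound[OF tendsto_mult_left]) (auto simp: x_def)
    then have S: "w ^ Suc m / 2 \<le> S" by simp
    have "(c * x powr (- r / \<alpha>))\<^sup>2 = 1/2 * (1 / (4 * x)) powr (2 * r / \<alpha>)"
    proof -
      have "4 powr (- r / \<alpha>) * x powr (- r / \<alpha>) = (1 / (4 * x)) powr (r / \<alpha>)"
        using x(1)[folded x_def] by (simp add: powr_mult powr_minus_divide powr_divide)
      then have "c * x powr (- r / \<alpha>) = sqrt (1/2) * (1 / (4 * x)) powr (r / \<alpha>)"
        unfolding c_def mult.assoc by (rule arg_cong)
      moreover have "((1 / (4 * x)) powr (r / \<alpha>))\<^sup>2 = (1 / (4 * x)) powr (2 * r / \<alpha>)"
        unfolding power2_eq_square powr_add[symmetric] by simp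
      moreover have "(sqrt (1/2))\<^sup>2 = (1/2 :: real)" by (rule real_sqrt_pow2) simp
      ultimately show ?thesis by (simp only: power_mult_distrib)
    qed
    also have "\<dots> \<le> 1/2 * (\<mu> ^ Suc m) powr (2 * r / \<alpha>)"
      using m(2) x r assms by (intro mult_left_mono powr_mono2) (auto simp: x_def)
    also have "(\<mu> ^ Suc m) powr (2 * r / \<alpha>) = w ^ Suc m"
    proof -
      have "(\<mu> ^ Suc m) powr (2 * r / \<alpha>) = (\<mu> powr (2 * r / \<alpha>)) ^ Suc m"
        using shell_powr[of \<mu> "Suc m"] mu by (simp add: shell_def)
      also have "\<mu> powr (2 * r / \<alpha>) = w"
        using assms by (simp add: \<mu>_def w_def powr_powr)
      finally show ?thesis .
    qed
    finally have "(c * x powr (- r / \<alpha>))\<^sup>2 \<le> S" using S by simp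
    then show "c * (T - t) powr (- r / \<alpha>) \<le> Hs_norm lam r (Y t)"
      unfolding Hs_norm_def x_def[symmetric] S_def[symmetric] by (rule real_le_rsqrt)
  qed
  show ?thesis
    by (intro exI[of _ Y] conjI)
      (use solution C1 norm1 cont_pre cont_all blowup Znonneg Zneg in \<open>auto simp: Y_def\<close>)
qed

end
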